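(* Let $g\ge2$, let $\rho_1,\rho_2\colon\pi_1\Sigma_g\to PSL(2,\mathbb R)$ be two non discrete, non elementary representations, and let $a_1,a_2\in\partial\mathbb{H}^2$. Suppose that for all $\gamma_1,\gamma_2,\gamma_3\in\pi_1\Sigma_g$, \[ o(\rho_1(\gamma_1)\cdot a_1,\rho_1(\gamma_2)\cdot a_1,\rho_1(\gamma_3)\cdot a_1)=o(\rho_2(\gamma_1)\cdot a_2,\rho_2(\gamma_2)\cdot a_2,\rho_2(\gamma_3)\cdot a_2). \] Then there exists $A\in PSL(2,\mathbb R)$ such that $\rho_1=A\rho_2 A^{-1}$.
   Context: $\Sigma_g$ is the closed oriented surface of genus $g$. $PSL(2,\mathbb R)=\mathrm{Isom}^+(\mathbb H^2)$ acts on $\partial\mathbb H^2=\mathbb S^1$. The natural cyclic order $o$ on $\partial\mathbb H^2=\mathbb S^1$ is: $o(a,b,c)=0$ if two of the three points coincide, $1$ if $a,b,c$ are met in the anticlockwise order on the circle, and $-1$ otherwise. A representation is non discrete if its image is a non discrete subgroup of $PSL(2,\mathbb R)$. A representation is elementary if it has a global fixed point in $\mathbb H^2\cup\partial\mathbb H^2$, and non elementary otherwise.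
   Formalization: "Non elementary" here also excludes representations preserving a pair of points of the boundary circle; with only global fixed points excluded the claim fails, e.g. for non-discrete translations along one geodesic together with a half-turn exchanging its ends. *)

theory Defs
  imports "HOL-Analysis.Analysis" "HOL-Algebra.Coset"
begin

section \<open>The closed oriented surface of genus \<open>g\<close>\<close>

text \<open>
  The unit disc is viewed as a \<open>4g\<close>-gon whose \<open>k\<close>-th side is the arc
  \<open>cis (2 * pi * (k + t) / (4 * g))\<close>, \<open>0 \<le> t \<le> 1\<close>.  Its boundary word is
  \<open>a\<^sub>1 b\<^sub>1 a\<^sub>1\<inverse> b\<^sub>1\<inverse> \<dots> a\<^sub>g b\<^sub>g a\<^sub>g\<inverse> b\<^sub>g\<inverse>\<close>: a side \<open>k\<close> with \<open>k mod 4\<close> equal to \<open>0\<close> or \<open>1\<close>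
  is glued to the side \<open>k + 2\<close> with reversed parameter, \<open>k + 2 + (1 - t) = k + 3 - t\<close>.
\<close>

definition side_pairing :: "nat \<Rightarrow> (complex \<times> complex) set" where
  "side_pairing g =
     {(cis (2 * pi * (real k + t) / (4 * real g)), cis (2 * pi * (real k + 3 - t) / (4 * real g))) | k t.
        k < 4 * g \<and> k mod 4 \<in> {0, 1} \<and> 0 \<le> t \<and> t \<le> 1}"

text \<open>Being a quotient of the polygon with exactly these fibres determines \<open>S\<close> up to homeomorphism.\<close>

definition closed_surface :: "nat \<Rightarrow> 'a::topological_space set \<Rightarrow> bool" where
  "closed_surface g S \<longleftrightarrow>
     (\<exists>q. quotient_map (top_of_set (cball (0::complex) 1)) (top_of_set S) q \<and>
          (\<forall>z\<in>cball 0 1. \<forall>w\<in>cball 0 1.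
             q z = q w \<longleftrightarrow> (z, w) \<in> (side_pairing g \<union> (side_pairing g)\<inverse>)\<^sup>*))"


section \<open>Fundamental groups\<close>

definition path_class :: "'a::topological_space set \<Rightarrow> (real \<Rightarrow> 'a) \<Rightarrow> (real \<Rightarrow> 'a) set" where
  "path_class S p = {r. homotopic_paths S p r}"

definition fundamental_group :: "'a::topological_space set \<Rightarrow> 'a \<Rightarrow> (real \<Rightarrow> 'a) set monoid" where
  "fundamental_group S x =
     \<lparr>carrier = path_class S ` {p. path p \<and> path_image p \<subseteq> S \<and> pathstart p = x \<and> pathfinish p = x},
      mult = (\<lambda>P Q. \<Union>p\<in>P. \<Union>q\<in>Q. path_class S (p +++ q)),
      one = path_class S (\<lambda>_. x)\<rparr>"

lemma path_class_eq_iff: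
  assumes "path p" "path_image p \<subseteq> S"
  shows "path_class S p = path_class S q \<longleftrightarrow> homotopic_paths S p q"
proof
  assume "path_class S p = path_class S q"
  moreover have "p \<in> path_class S p"
    using assms by (simp add: path_class_def)
  ultimately show "homotopic_paths S p q"
    by (simp add: path_class_def homotopic_paths_sym)
next
  assume h: "homotopic_paths S p q"
  have "homotopic_paths S p r \<longleftrightarrow> homotopic_paths S q r" for r
    using homotopic_paths_trans[OF h, of r] homotopic_paths_trans[OF homotopic_paths_sym[OF h], of r]
    by blast
  then show "path_class S p = path_class S q"
    by (simp add: path_class_def)
qed

lemma fundamental_group_mult:
  assumes "path p" "path_image p \<subseteq> S" "path q" "path_image q \<subseteq> S" "pathfinish p = pathstart q"
  shows "path_class S p \<otimes>\<^bsub>fundamental_group S x\<^esub> path_class S q = path_class S (p +++ q)"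
proof -
  let ?P = "path_class S p" and ?Q = "path_class S q"
  have const: "path_class S (p' +++ q') = path_class S (p +++ q)"
    if "p' \<in> path_class S p" "q' \<in> path_class S q" for p' q'
  proof -
    have "homotopic_paths S (p +++ q) (p' +++ q')"
      using that assms(5) by (intro homotopic_paths_join) (auto simp: path_class_def)
    moreover have "path (p +++ q)" "path_image (p +++ q) \<subseteq> S"
      using assms by (simp_all add: subset_path_image_join)
    ultimately show ?thesis
      using path_class_eq_iff by blast
  qed
  have ne: "?P \<noteq> {}" "?Q \<noteq> {}"
    using assms(1-4) homotopic_paths_refl unfolding path_class_def by blast+
  have "?P \<otimes>\<^bsub>fundamental_group S x\<^esub> ?Q = (\<Union>p'\<in>?P. \<Union>q'\<in>?Q. path_class S (p' +++ q'))"
    by (simp add: fundamental_group_def)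
  also have "\<dots> = (\<Union>p'\<in>?P. \<Union>q'\<in>?Q. path_class S (p +++ q))"
    by (intro SUP_cong refl const)
  also have "\<dots> = path_class S (p +++ q)"
    using ne by (simp only: UN_constant if_False)
  finally show ?thesis .
qed

text \<open>The library has the inverse and unit laws for normed spaces only; the general case follows
  by composing with the path.\<close>

lemma homotopic_paths_reparam:
  fixes u v :: "real \<Rightarrow> real"
  assumes p: "path p" "path_image p \<subseteq> S"
    and uv: "path u" "path v" "path_image u \<subseteq> {0..1}" "path_image v \<subseteq> {0..1}"
    and ends: "pathstart v = pathstart u" "pathfinish v = pathfinish u"
  shows "homotopic_paths S (p \<circ> u) (p \<circ> v)"
proof -
  have "closed_segment (u t) (v t) \<subseteq> {0..1}" if "t \<in> {0..1}" for t
  proof (rule closed_segment_subset)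
    show "u t \<in> {0..1}" "v t \<in> {0..1}"
      using uv(3,4) that unfolding path_image_def by blast+
  qed simp
  then have "homotopic_paths {0..1} u v"
    by (rule homotopic_paths_linear[OF uv(1,2) ends])
  from homotopic_paths_continuous_image[OF this, of p S] p show ?thesis
    by (auto simp: path_def path_image_def)
qed

lemma group_fundamental_group:
  assumes "x \<in> S"
  shows "group (fundamental_group S x)"
proof -
  define L where "L = {p. path p \<and> path_image p \<subseteq> S \<and> pathstart p = x \<and> pathfinish p = x}"
  have car: "carrier (fundamental_group S x) = path_class S ` L"
    and one: "\<one>\<^bsub>fundamental_group S x\<^esub> = path_class S (\<lambda>_. x)"
    by (auto simp: fundamental_group_def L_def)
  have join: "p +++ q \<in> L" if "p \<in> L" "q \<in> L" for p q
    using that subset_path_image_join[of p S q] by (auto simp: L_def)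
  have mult: "path_class S p \<otimes>\<^bsub>fundamental_group S x\<^esub> path_class S q = path_class S (p +++ q)"
    if "p \<in> L" "q \<in> L" for p q
    by (rule fundamental_group_mult) (use that in \<open>auto simp: L_def\<close>)
  have const: "(\<lambda>_. x) \<in> L"
    using assms by (auto simp: L_def path_def path_image_def pathstart_def pathfinish_def)
  have eqI: "path_class S p = path_class S q" if "p \<in> L" "homotopic_paths S p q" for p q
    using that path_class_eq_iff[of p S q] by (auto simp: L_def)
  show ?thesis
  proof (rule groupI)
    show "\<one>\<^bsub>fundamental_group S x\<^esub> \<in> carrier (fundamental_group S x)"
      using const by (auto simp: car one)
    fix P assume "P \<in> carrier (fundamental_group S x)"
    then obtain p where p: "p \<in> L" "P = path_class S p" by (auto simp: car)
    have pS: "path p" "path_image p \<subseteq> S" "p 0 = x" "p 1 = x"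
      using p by (auto simp: L_def pathstart_def pathfinish_def)
    have "homotopic_paths S (p \<circ> (linepath 0 0 +++ linepath 0 1)) (p \<circ> linepath 0 1)"
      by (rule homotopic_paths_reparam[OF pS(1,2)])
        (auto simp: path_image_join closed_segment_eq_real_ivl)
    moreover have "p \<circ> linepath 0 1 = p"
      by (auto simp: linepath_def fun_eq_iff)
    moreover have "p \<circ> (linepath 0 0 +++ linepath 0 1) = (\<lambda>_. x) +++ p"
      using pS by (auto simp: linepath_def fun_eq_iff joinpaths_def)
    ultimately have "path_class S ((\<lambda>_. x) +++ p) = path_class S p"
      using eqI[OF join[OF const p(1)]] by simp
    then show "\<one>\<^bsub>fundamental_group S x\<^esub> \<otimes>\<^bsub>fundamental_group S x\<^esub> P = P"
      using p const by (simp add: one mult)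
    have "homotopic_paths S (p \<circ> (linepath 1 0 +++ linepath 0 1)) (p \<circ> linepath 1 1)"
      by (rule homotopic_paths_reparam[OF pS(1,2)])
        (auto simp: path_image_join closed_segment_eq_real_ivl)
    moreover have "p \<circ> linepath 1 1 = (\<lambda>_. x)"
      using pS by (auto simp: linepath_def fun_eq_iff)
    moreover have "p \<circ> (linepath 1 0 +++ linepath 0 1) = reversepath p +++ p"
      by (auto simp: linepath_def fun_eq_iff joinpaths_def reversepath_def)
    moreover have rev: "reversepath p \<in> L"
      using p by (auto simp: L_def)
    ultimately have "path_class S (reversepath p +++ p) = path_class S (\<lambda>_. x)"
      using eqI[OF join[OF rev p(1)]] by simp
    then show "\<exists>Q\<in>carrier (fundamental_group S x). Q \<otimes>\<^bsub>fundamental_group S x\<^esub> P = \<one>\<^bsub>fundamental_group S x\<^esub>"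
      using p rev by (intro bexI[of _ "path_class S (reversepath p)"]) (auto simp: car one mult)
    fix Q assume "Q \<in> carrier (fundamental_group S x)"
    then obtain q where q: "q \<in> L" "Q = path_class S q" by (auto simp: car)
    show "P \<otimes>\<^bsub>fundamental_group S x\<^esub> Q \<in> carrier (fundamental_group S x)"
      using p q join by (auto simp: car mult)
    fix R assume "R \<in> carrier (fundamental_group S x)"
    then obtain r where r: "r \<in> L" "R = path_class S r" by (auto simp: car)
    have "homotopic_paths S (p +++ (q +++ r)) ((p +++ q) +++ r)"
      using p q r by (intro homotopic_paths_assoc) (auto simp: L_def)
    then have "path_class S ((p +++ q) +++ r) = path_class S (p +++ (q +++ r))"
      using eqI[OF join[OF p(1) join[OF q(1) r(1)]]] by simp
    then show "P \<otimes>\<^bsub>fundamental_group S x\<^esub> Q \<otimes>\<^bsub>fundamental_group S x\<^esub> R =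
               P \<otimes>\<^bsub>fundamental_group S x\<^esub> (Q \<otimes>\<^bsub>fundamental_group S x\<^esub> R)"
      using p q r join by (simp add: mult)
  qed
qed


section \<open>The group \<open>PSL(2,\<real>)\<close>\<close>

definition SL2R :: "(real^2^2) monoid" where
  "SL2R = \<lparr>carrier = {A. det A = 1}, mult = (**), one = mat 1\<rparr>"

definition PSL2R :: "(real^2^2) set monoid" where
  "PSL2R = SL2R Mod {mat 1, - mat 1}"

definition PSL2R_topology :: "(real^2^2) set topology" where
  "PSL2R_topology =
     topology (\<lambda>U. U \<subseteq> carrier PSL2R \<and> openin (top_of_set (carrier SL2R)) (\<Union>U))"

lemma det_minus_2: "det (- A) = det (A :: real^2^2)"
  by (simp add: det_2)

lemma group_SL2R: "group SL2R"
proof (rule groupI)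
  fix A assume "A \<in> carrier SL2R"
  then have "det A = 1" by (simp add: SL2R_def)
  then obtain B where B: "A ** B = mat 1" "B ** A = mat 1"
    by (metis invertible_def invertible_det_nz zero_neq_one)
  then have "det B = 1"
    using \<open>det A = 1\<close> by (metis det_I det_mul mult_1)
  with B show "\<exists>B\<in>carrier SL2R. B \<otimes>\<^bsub>SL2R\<^esub> A = \<one>\<^bsub>SL2R\<^esub>"
    by (auto simp: SL2R_def)
qed (auto simp: SL2R_def det_mul matrix_mul_assoc)

lemma minus_one_mult: "(- mat 1) ** A = - (A :: real^2^2)" "A ** (- mat 1) = - A"
  by (simp_all add: vec_eq_iff matrix_matrix_mult_def forall_2 sum_2 mat_def)

lemma coset_SL2R: "{mat 1, - mat 1} #>\<^bsub>SL2R\<^esub> A = {A, - A}"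
  by (auto simp: r_coset_def SL2R_def minus_one_mult)

lemma normal_SL2R: "{mat 1, - mat 1} \<lhd> SL2R"
proof -
  interpret group SL2R by (rule group_SL2R)
  have sub: "subgroup {mat 1, - mat 1} SL2R"
  proof (rule subgroupI)
    have "inv\<^bsub>SL2R\<^esub> (mat 1) = mat 1"
      using inv_one by (simp add: SL2R_def)
    moreover have "inv\<^bsub>SL2R\<^esub> (- mat 1) = - mat 1"
      by (rule inv_equality) (auto simp: SL2R_def minus_one_mult det_minus_2)
    ultimately show "inv\<^bsub>SL2R\<^esub> A \<in> {mat 1, - mat 1}" if "A \<in> {mat 1, - mat 1}" for A
      using that by auto
  qed (auto simp: SL2R_def minus_one_mult det_minus_2)
  show ?thesis
    by (rule normalI[OF sub]) (auto simp: coset_SL2R, auto simp: l_coset_def SL2R_def minus_one_mult)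
qed

lemma group_PSL2R: "group PSL2R"
  unfolding PSL2R_def by (rule normal.factorgroup_is_group[OF normal_SL2R])

lemma carrier_SL2R: "carrier SL2R = {A. det A = 1}"
  by (simp add: SL2R_def)

lemma carrier_PSL2R: "carrier PSL2R = (\<lambda>A. {A, - A}) ` {A. det A = 1}"
  by (auto simp: PSL2R_def FactGroup_def RCOSETS_def coset_SL2R carrier_SL2R)

lemma quotient_map_PSL2R:
  "quotient_map (top_of_set (carrier SL2R)) PSL2R_topology (\<lambda>A. {mat 1, - mat 1} #>\<^bsub>SL2R\<^esub> A)"
proof -
  let ?o = "\<lambda>U. U \<subseteq> carrier PSL2R \<and> openin (top_of_set (carrier SL2R)) (\<Union>U)"
  have pre: "{A \<in> carrier SL2R. {A, - A} \<in> U} = \<Union>U" if "U \<subseteq> carrier PSL2R" for U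
  proof (rule subset_antisym; rule subsetI)
    fix A assume "A \<in> \<Union>U"
    then obtain P where P: "P \<in> U" "A \<in> P" by blast
    then obtain B where "P = {B, - B}" "det B = 1"
      using \<open>U \<subseteq> carrier PSL2R\<close> by (auto simp: carrier_PSL2R)
    with P show "A \<in> {A \<in> carrier SL2R. {A, - A} \<in> U}"
      by (auto simp: SL2R_def det_minus_2 insert_commute)
  qed auto
  have "istopology ?o"
    unfolding istopology_def
  proof (intro conjI allI impI)
    fix U V assume UV: "?o U" "?o V"
    then have "U \<inter> V \<subseteq> carrier PSL2R" by blast
    then have "\<Union>(U \<inter> V) = {A \<in> carrier SL2R. {A, - A} \<in> U} \<inter> {A \<in> carrier SL2R. {A, - A} \<in> V}"
      by (subst pre[symmetric]) auto
    then show "openin (top_of_set (carrier SL2R)) (\<Union>(U \<inter> V))"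
      using UV by (simp add: pre openin_Int)
  next
    fix K assume K: "\<forall>U\<in>K. ?o U"
    have "\<Union>(\<Union>K) = \<Union>(Union ` K)" by blast
    then show "openin (top_of_set (carrier SL2R)) (\<Union>(\<Union>K))"
      using K by (simp only:) (intro openin_Union, blast)
  qed auto
  then have opn: "openin PSL2R_topology = ?o"
    unfolding PSL2R_topology_def by (rule topology_inverse')
  have "\<Union>(carrier PSL2R) = carrier SL2R"
    by (auto simp: carrier_PSL2R SL2R_def det_minus_2)
  then have "?o (carrier PSL2R)" by simp
  then have top: "topspace PSL2R_topology = carrier PSL2R"
    unfolding topspace_def opn by blast
  show ?thesis
    unfolding quotient_map_def
  proof (intro conjI allI impI)
    show "(\<lambda>A. {mat 1, - mat 1} #>\<^bsub>SL2R\<^esub> A) ` topspace (top_of_set (carrier SL2R)) =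
          topspace PSL2R_topology"
      by (simp add: top coset_SL2R carrier_PSL2R carrier_SL2R)
  qed (simp add: coset_SL2R top opn pre)
qed


section \<open>The action on the closed hyperbolic plane\<close>

text \<open>
  The hyperbolic plane is the Poincare disc \<open>ball 0 1\<close>, with boundary \<open>sphere 0 1\<close>.  The group
  acts on the upper half-plane by Moebius transformations; this is transported to the disc by the
  Cayley map \<open>w \<mapsto> (w - \<i>) / (w + \<i>)\<close>.  The formula is written in homogeneous coordinates, since
  the inverse Cayley map sends \<open>1\<close> to infinity: it sends \<open>z\<close> to \<open>[\<i> * (1 + z) : 1 - z]\<close>.
\<close>

definition cayley :: "complex \<Rightarrow> complex" where
  "cayley w = (w - \<i>) / (w + \<i>)"

definition SL2R_act :: "real^2^2 \<Rightarrow> complex \<Rightarrow> complex" where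
  "SL2R_act A z =
     (let u = of_real (A $ 1 $ 1) * (\<i> * (1 + z)) + of_real (A $ 1 $ 2) * (1 - z);
          v = of_real (A $ 2 $ 1) * (\<i> * (1 + z)) + of_real (A $ 2 $ 2) * (1 - z)
      in (u - \<i> * v) / (u + \<i> * v))"

definition PSL2R_act :: "(real^2^2) set \<Rightarrow> complex \<Rightarrow> complex" where
  "PSL2R_act P z = the_elem ((\<lambda>A. SL2R_act A z) ` P)"

lemma SL2R_act_cayley:
  assumes w: "w + \<i> \<noteq> 0"
    and den: "of_real (A $ 2 $ 1) * w + of_real (A $ 2 $ 2) \<noteq> (0::complex)"
  shows "SL2R_act A (cayley w) =
    cayley ((of_real (A $ 1 $ 1) * w + of_real (A $ 1 $ 2)) / (of_real (A $ 2 $ 1) * w + of_real (A $ 2 $ 2)))"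
proof -
  define c where "c = 2 * \<i> / (w + \<i>)"
  have c: "c \<noteq> 0" "\<i> * (1 + cayley w) = c * w" "1 - cayley w = c"
    using w by (simp_all add: c_def cayley_def field_simps)
  define U where "U = of_real (A $ 1 $ 1) * w + of_real (A $ 1 $ 2)"
  define V where "V = of_real (A $ 2 $ 1) * w + of_real (A $ 2 $ 2)"
  have "SL2R_act A (cayley w) = (c * U - \<i> * (c * V)) / (c * U + \<i> * (c * V))"
    unfolding SL2R_act_def Let_def c U_def V_def by (simp add: algebra_simps)
  also have "\<dots> = (c * (U - \<i> * V)) / (c * (U + \<i> * V))"
    by (simp add: algebra_simps)
  also have "\<dots> = (U - \<i> * V) / (U + \<i> * V)"
    using c(1) by simp
  also have "\<dots> = cayley (U / V)"
    using den unfolding cayley_def V_def[symmetric] by (simp add: divide_simps mult.commute)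
  finally show ?thesis unfolding U_def V_def .
qed

lemma PSL2R_act_coset: "PSL2R_act ({mat 1, - mat 1} #>\<^bsub>SL2R\<^esub> A) z = SL2R_act A z"
proof -
  have "SL2R_act (- A) z = SL2R_act A z"
    unfolding SL2R_act_def Let_def
    by (subst minus_divide_divide[symmetric]) (simp add: algebra_simps)
  then show ?thesis
    by (simp add: PSL2R_act_def coset_SL2R)
qed


section \<open>The cyclic order on the circle\<close>

definition cyc_order :: "complex \<Rightarrow> complex \<Rightarrow> complex \<Rightarrow> int" where
  "cyc_order a b c =
     (if a = b \<or> b = c \<or> a = c then 0
      else if \<exists>s t. 0 < s \<and> s < t \<and> t < 2 * pi \<and> b = a * cis s \<and> c = a * cis t then 1
      else - 1)"


section \<open>Representations\<close>

definition discrete_rep :: "('g, 'm) monoid_scheme \<Rightarrow> ('g \<Rightarrow> (real^2^2) set) \<Rightarrow> bool" where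
  "discrete_rep G \<rho> \<longleftrightarrow>
     subtopology PSL2R_topology (\<rho> ` carrier G) = discrete_topology (\<rho> ` carrier G)"

definition has_global_fixed_point :: "('g, 'm) monoid_scheme \<Rightarrow> ('g \<Rightarrow> (real^2^2) set) \<Rightarrow> bool" where
  "has_global_fixed_point G \<rho> \<longleftrightarrow>
     (\<exists>z\<in>ball 0 1 \<union> sphere 0 1. \<forall>\<gamma>\<in>carrier G. PSL2R_act (\<rho> \<gamma>) z = z)"

definition has_invariant_boundary_pair :: "('g, 'm) monoid_scheme \<Rightarrow> ('g \<Rightarrow> (real^2^2) set) \<Rightarrow> bool" where
  "has_invariant_boundary_pair G \<rho> \<longleftrightarrow>
     (\<exists>a\<in>sphere 0 1. \<exists>b\<in>sphere 0 1. a \<noteq> b \<and> (\<forall>\<gamma>\<in>carrier G. PSL2R_act (\<rho> \<gamma>) ` {a, b} = {a, b}))"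

text \<open>
  A subgroup of \<open>PSL(2,\<real>)\<close> is elementary if it has a finite orbit in the closed hyperbolic plane,
  that is, if it has a global fixed point there or preserves a pair of boundary points.  The second
  clause cannot be dropped here: a non-discrete group of translations along a geodesic, extended by
  a half-turn exchanging the two ends, has no global fixed point, but its translation lengths are
  not determined by the cyclic order on an orbit (for an endpoint \<open>a\<close>, the orbit has two elements
  and the cyclic order vanishes identically on it).
\<close>

definition elementary_rep :: "('g, 'm) monoid_scheme \<Rightarrow> ('g \<Rightarrow> (real^2^2) set) \<Rightarrow> bool" where
  "elementary_rep G \<rho> \<longleftrightarrow> has_global_fixed_point G \<rho> \<or> has_invariant_boundary_pair G \<rho>"

end

theory Submission
  imports Defs
begin

text \<open>
  A non-discrete, non-elementary subgroup of \<open>PSL(2,\<real>)\<close> is dense: the Lie algebra of its closure is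
  nonzero and invariant under conjugation, and a common eigenvector of the conjugations would be
  parabolic, hyperbolic or elliptic and so provide a fixed point on the circle, an invariant pair,
  or a fixed point in the disc.  Both orbits are therefore dense in the circle, and the closure
  of the set of pairs \<open>(\<rho>\<^sub>1(\<gamma>) a\<^sub>1, \<rho>\<^sub>2(\<gamma>) a\<^sub>2)\<close> is the graph of an equivariant bijection \<open>h\<close> of the circle that
  preserves the cyclic order.  By density, \<open>h\<close> conjugates every element of \<open>PSL(2,\<real>)\<close> into
  \<open>PSL(2,\<real>)\<close>.  After composing \<open>h\<close> with an element of \<open>PSL(2,\<real>)\<close> it fixes \<open>\<infinity>\<close>, \<open>0\<close> and \<open>1\<close>, so it
  conjugates translations to translations; it is then additive and increasing on \<open>\<real>\<close>, hence the
  identity.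
\<close>

section \<open>Powers of matrices near the identity\<close>

text \<open>Only nilpotent tangent vectors have to be exponentiated: the elementary matrices are I +
  X with X nilpotent, and they generate SL(2,\<real>). Elements of PSL(2,\<real>) are replaced by
  their two lifts and points of the circle by lines in the plane. The action then becomes linear,
  and the cyclic order is the sign of a product of three 2x2 determinants. The map h is kept as a
  closed relation whose defining conditions are symmetric in the two circles, so its injectivity and
  surjectivity are the functionality and totality of the converse. The obstacle in passing from the
  image of \<rho>1 to the whole group is that the partners B_n of a convergent sequence A_n are not
  known to be bounded; they are normalised, and a limit of rank one has to be excluded. Preservation
  of orientation enters twice: it puts the normalising element into PSL(2,\<real>) rather than
  PGL(2,\<real>), and it makes h increasing on the line, which rules out the wild additive
  functions.\<close>

lemma matrix_eq_2:
  fixes A B :: "'a^2^2"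
  shows "A = B \<longleftrightarrow> A$1$1 = B$1$1 \<and> A$1$2 = B$1$2 \<and> A$2$1 = B$2$1 \<and> A$2$2 = B$2$2"
  by (auto simp: vec_eq_iff forall_2)

lemma matrix_mult_nth_2:
  fixes A B :: "'a::semiring_1^2^2"
  shows "(A ** B) $ i $ j = A$i$1 * B$1$j + A$i$2 * B$2$j"
  by (simp add: matrix_matrix_mult_def sum_2)

lemma mat_nth: "mat c $ i $ j = (if i = j then c else 0)"
  by (simp add: mat_def)

lemmas matrix_simps_2 = matrix_eq_2 matrix_mult_nth_2 mat_nth

definition mat2 :: "real \<Rightarrow> real \<Rightarrow> real \<Rightarrow> real \<Rightarrow> real^2^2" where
  "mat2 a b c d = vector [vector [a, b], vector [c, d]]"

lemma mat2_nth [simp]: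
  "mat2 a b c d $ 1 $ 1 = a" "mat2 a b c d $ 1 $ 2 = b"
  "mat2 a b c d $ 2 $ 1 = c" "mat2 a b c d $ 2 $ 2 = d"
  by (simp_all add: mat2_def)

lemma det_mat2 [simp]: "det (mat2 a b c d) = a * d - b * c"
  by (simp add: det_2)

text \<open>The norm on nested vectors is the Frobenius norm. Each row of the product is a
  combination of the rows of B, and Cauchy-Schwarz applies to its coefficients.\<close>

lemma norm_matrix_mult_le:
  fixes A :: "real^'n^'m" and B :: "real^'k^'n"
  shows "norm (A ** B) \<le> norm A * norm B"
proof -
  have row: "norm ((A ** B) $ i) \<le> norm (A $ i) * norm B" for i
  proof -
    have "(A ** B) $ i = (\<Sum>k\<in>UNIV. (A $ i $ k) *\<^sub>R (B $ k))"
      by (simp add: vec_eq_iff matrix_matrix_mult_def)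
    also have "norm \<dots> \<le> (\<Sum>k\<in>UNIV. \<bar>A $ i $ k\<bar> * \<bar>norm (B $ k)\<bar>)"
      by (rule order_trans[OF norm_sum]) simp
    also have "\<dots> \<le> L2_set (\<lambda>k. A $ i $ k) UNIV * L2_set (\<lambda>k. norm (B $ k)) UNIV"
      by (rule L2_set_mult_ineq)
    also have "\<dots> = norm (A $ i) * norm B"
      by (simp add: norm_vec_def L2_set_def)
    finally show ?thesis .
  qed
  have "norm (A ** B) = L2_set (\<lambda>i. norm ((A ** B) $ i)) UNIV"
    by (simp add: norm_vec_def)
  also have "\<dots> \<le> L2_set (\<lambda>i. norm (A $ i) * norm B) UNIV"
    by (rule L2_set_mono) (auto simp: row)
  also have "\<dots> = norm A * norm B"
    by (subst L2_set_left_distrib[symmetric]) (auto simp: norm_vec_def)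
  finally show ?thesis .
qed

lemma bounded_bilinear_matrix_mult:
  "bounded_bilinear ((**) :: real^'n^'m \<Rightarrow> real^'k^'n \<Rightarrow> real^'k^'m)"
proof
  show "\<exists>K. \<forall>(A :: real^'n^'m) (B :: real^'k^'n). norm (A ** B) \<le> norm A * norm B * K"
    by (rule exI[of _ 1]) (simp add: norm_matrix_mult_le)
qed (simp_all add: matrix_matrix_mult_def vec_eq_iff algebra_simps sum.distrib sum_distrib_left)

lemmas tendsto_matrix_mult = bounded_bilinear.tendsto[OF bounded_bilinear_matrix_mult]
lemmas matrix_scaleR_mult_left = bounded_bilinear.scaleR_left[OF bounded_bilinear_matrix_mult]
lemmas matrix_scaleR_mult_right = bounded_bilinear.scaleR_right[OF bounded_bilinear_matrix_mult]
lemmas matrix_distribs =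
  bounded_bilinear.add_left[OF bounded_bilinear_matrix_mult]
  bounded_bilinear.add_right[OF bounded_bilinear_matrix_mult]
  bounded_bilinear.diff_left[OF bounded_bilinear_matrix_mult]
  bounded_bilinear.diff_right[OF bounded_bilinear_matrix_mult]
  matrix_scaleR_mult_left matrix_scaleR_mult_right

lemma tendsto_det_2:
  fixes A :: "'b \<Rightarrow> real^2^2"
  assumes "(A \<longlongrightarrow> B) F"
  shows "((\<lambda>n. det (A n)) \<longlongrightarrow> det B) F"
  unfolding det_2 by (intro tendsto_intros assms)

definition matpow :: "real^'n^'n \<Rightarrow> nat \<Rightarrow> real^'n^'n" where
  "matpow A n = (((**) A) ^^ n) (mat 1)"

lemma matpow_0 [simp]: "matpow A 0 = mat 1"
  and matpow_Suc [simp]: "matpow A (Suc n) = A ** matpow A n"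
  by (simp_all add: matpow_def)

text \<open>With E = A - I, this compares the binomial expansions of (I + E)^m and (1 + |E|)^m after
  removal of the constant term.\<close>

lemma norm_matpow_minus_one_le:
  "norm (matpow A m - mat 1) \<le> (1 + norm (A - mat 1)) ^ m - 1"
proof (induction m)
  case (Suc m)
  let ?e = "norm (A - mat 1)"
  have "matpow A (Suc m) - mat 1 = (matpow A m - mat 1) + (A - mat 1) + (A - mat 1) ** (matpow A m - mat 1)"
    by (simp add: matrix_distribs)
  also have "norm \<dots> \<le> norm (matpow A m - mat 1) + ?e + ?e * norm (matpow A m - mat 1)"
    by (intro norm_triangle_mono order_refl norm_matrix_mult_le)
  also have "\<dots> \<le> ((1 + ?e) ^ m - 1) + ?e + ?e * ((1 + ?e) ^ m - 1)"
    by (intro add_mono mult_left_mono Suc order_refl norm_ge_zero)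
  finally show ?case by (simp add: algebra_simps)
qed simp

text \<open>The remainder R_m satisfies R_(m+1) = R_m + E ((I + E)^m - I), and the scalar bound
  satisfies the corresponding recursion with equality.\<close>

lemma norm_matpow_linear_approx_le:
  "norm (matpow A m - mat 1 - real m *\<^sub>R (A - mat 1))
     \<le> (1 + norm (A - mat 1)) ^ m - 1 - real m * norm (A - mat 1)"
proof (induction m)
  case (Suc m)
  let ?e = "norm (A - mat 1)"
  let ?R = "matpow A m - mat 1 - real m *\<^sub>R (A - mat 1)"
  have "matpow A (Suc m) - mat 1 - real (Suc m) *\<^sub>R (A - mat 1) =
        ?R + (A - mat 1) ** (matpow A m - mat 1)"
    by (simp add: matrix_distribs algebra_simps)
  also have "norm \<dots> \<le> norm ?R + ?e * norm (matpow A m - mat 1)"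
    by (intro norm_triangle_mono order_refl norm_matrix_mult_le)
  also have "\<dots> \<le> ((1 + ?e) ^ m - 1 - real m * ?e) + ?e * ((1 + ?e) ^ m - 1)"
    by (intro add_mono mult_left_mono Suc norm_matpow_minus_one_le norm_ge_zero)
  finally show ?case by (simp add: algebra_simps)
qed simp

text \<open>The scalar remainder is at most exp y - 1 - y for y = m |E|, and exp y \<le> 1 + y + y^2
  on the unit interval.\<close>

lemma norm_matpow_quadratic_approx_le:
  assumes "real m * norm (A - mat 1) \<le> 1"
  shows "norm (matpow A m - mat 1 - real m *\<^sub>R (A - mat 1)) \<le> (real m * norm (A - mat 1))\<^sup>2"
proof -
  let ?e = "norm (A - mat 1)"
  have "(1 + ?e) ^ m \<le> exp ?e ^ m"
    by (intro power_mono exp_ge_add_one_self) simp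
  also have "\<dots> = exp (real m * ?e)" by (simp add: exp_of_nat_mult)
  also have "\<dots> \<le> 1 + real m * ?e + (real m * ?e)\<^sup>2"
    using assms by (intro exp_bound) auto
  finally show ?thesis using norm_matpow_linear_approx_le[of A m] by linarith
qed

text \<open>For nilpotent \<open>X\<close>, \<open>I + X\<close> is the exponential of \<open>X\<close>, hence \<open>(I + X / n + o(1 / n))\<^sup>n\<close>
  converges to it.\<close>

lemma tendsto_matpow_nilpotent:
  fixes A :: "nat \<Rightarrow> real^'n^'n"
  assumes A: "(\<lambda>n. real n *\<^sub>R (A n - mat 1)) \<longlonglongrightarrow> X" and X: "X ** X = 0"
  shows "(\<lambda>n. matpow (A n) n) \<longlonglongrightarrow> mat 1 + X"
proof -
  define K where "K = norm (mat 1 :: real^'n^'n) + norm X"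
  obtain M where M: "\<And>n. norm (real n *\<^sub>R (A n - mat 1)) \<le> M"
    using A convergent_imp_Bseq[of "\<lambda>n. real n *\<^sub>R (A n - mat 1)"]
    by (auto simp: convergent_def Bseq_def)
  define F where "F n = A n - mat 1 - (1 / real n) *\<^sub>R X" for n
  \<comment> \<open>Since X X = 0, multiplying I + (m/n) X by I + X/n gives exactly I + ((m+1)/n) X.
    Each step therefore contributes only the one-step error \<open>F n\<close>, amplified by the
    later factors \<open>A n\<close>.\<close>
  have step: "norm (matpow (A n) m - (mat 1 + (real m / real n) *\<^sub>R X))
      \<le> real m * norm (F n) * K * (1 + norm (A n - mat 1)) ^ m" if "m \<le> n" "n > 0" for m n
    using that(1)
  proof (induction m)
    case (Suc m)
    let ?e = "norm (A n - mat 1)"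
    let ?D = "matpow (A n) m - (mat 1 + (real m / real n) *\<^sub>R X)"
    have "(real m / real n) \<le> 1" using Suc.prems by simp
    then have "norm ((real m / real n) *\<^sub>R X) \<le> norm X"
      using mult_right_mono[of "real m / real n" 1 "norm X"] by simp
    then have K: "norm (mat 1 + (real m / real n) *\<^sub>R X) \<le> K"
      unfolding K_def by (intro order_trans[OF norm_triangle_ineq] add_left_mono)
    have "matpow (A n) (Suc m) - (mat 1 + (real (Suc m) / real n) *\<^sub>R X) =
       ?D + (A n - mat 1) ** ?D + F n ** (mat 1 + (real m / real n) *\<^sub>R X)"
      using X by (simp add: F_def matrix_distribs algebra_simps add_divide_distrib)
    also have "norm \<dots> \<le> norm ?D + ?e * norm ?D + norm (F n) * K"
      by (intro norm_triangle_mono order_refl order_trans[OF norm_matrix_mult_le] mult_left_mono K)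
        auto
    also have "\<dots> = (1 + ?e) * norm ?D + norm (F n) * K"
      by (simp add: algebra_simps)
    also have "\<dots> \<le> (1 + ?e) * (real m * norm (F n) * K * (1 + ?e) ^ m) + norm (F n) * K * (1 + ?e) ^ Suc m"
    proof (intro add_mono mult_left_mono Suc.IH)
      have "0 \<le> norm (F n) * K" by (simp add: K_def)
      moreover have "1 \<le> (1 + ?e) ^ Suc m" by (rule one_le_power) simp
      ultimately show "norm (F n) * K \<le> norm (F n) * K * (1 + ?e) ^ Suc m"
        using mult_left_mono by fastforce
    qed (use Suc.prems in auto)
    finally show ?case by (simp add: algebra_simps)
  qed simp
  have F: "(\<lambda>n. real n * norm (F n)) \<longlonglongrightarrow> 0"
  proof -
    have "(\<lambda>n. norm (real n *\<^sub>R (A n - mat 1) - X)) \<longlonglongrightarrow> norm (X - X)"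
      by (intro tendsto_intros A)
    moreover have "\<forall>\<^sub>F n in sequentially. norm (real n *\<^sub>R (A n - mat 1) - X) = real n * norm (F n)"
      using eventually_gt_at_top[of 0]
    proof eventually_elim
      case (elim n)
      then have "real n *\<^sub>R (A n - mat 1) - X = real n *\<^sub>R F n"
        by (simp add: F_def algebra_simps)
      then show ?case by simp
    qed
    ultimately show ?thesis by (simp add: tendsto_cong)
  qed
  have bound: "\<forall>\<^sub>F n in sequentially.
      norm (matpow (A n) n - (mat 1 + X)) \<le> real n * norm (F n) * (K * exp M)"
    using eventually_gt_at_top[of 0]
  proof eventually_elim
    case (elim n)
    have "(1 + norm (A n - mat 1)) ^ n \<le> exp (norm (A n - mat 1)) ^ n"
      by (intro power_mono exp_ge_add_one_self) simp
    also have "\<dots> = exp (real n * norm (A n - mat 1))" by (simp add: exp_of_nat_mult)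
    also have "\<dots> \<le> exp M" using M[of n] by simp
    finally have "real n * norm (F n) * K * (1 + norm (A n - mat 1)) ^ n \<le> real n * norm (F n) * K * exp M"
      by (intro mult_left_mono) (simp_all add: K_def)
    with step[of n n] elim show ?case by (simp add: mult_ac)
  qed
  have "(\<lambda>n. real n * norm (F n) * (K * exp M)) \<longlonglongrightarrow> 0"
    using tendsto_mult_left_zero[OF F] by blast
  then have "(\<lambda>n. matpow (A n) n - (mat 1 + X)) \<longlonglongrightarrow> 0"
    by (rule Lim_null_comparison[OF bound])
  then show ?thesis by (simp add: LIM_zero_iff)
qed

section \<open>Subgroups of \<open>SL(2,\<real>)\<close> and their tangent spaces\<close>

text \<open>The adjugate is the inverse at determinant one. Its entries are linear in those of A, so
  limits can be taken entrywise and no invertibility condition enters the identities.\<close>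

definition adj2 :: "real^2^2 \<Rightarrow> real^2^2" where
  "adj2 A = mat2 (A$2$2) (- A$1$2) (- A$2$1) (A$1$1)"

lemma mult_adj2: "A ** adj2 A = det A *\<^sub>R mat 1" "adj2 A ** A = det A *\<^sub>R mat 1"
  by (simp_all add: matrix_simps_2 adj2_def det_2 algebra_simps)

lemma det_adj2 [simp]: "det (adj2 A) = det A"
  by (simp add: adj2_def det_2)

locale SL2_subgroup =
  fixes \<Gamma> :: "(real^2^2) set"
  assumes det_one: "A \<in> \<Gamma> \<Longrightarrow> det A = 1"
    and one_mem: "mat 1 \<in> \<Gamma>"
    and mult_mem: "A \<in> \<Gamma> \<Longrightarrow> B \<in> \<Gamma> \<Longrightarrow> A ** B \<in> \<Gamma>"
    and adj2_mem: "A \<in> \<Gamma> \<Longrightarrow> adj2 A \<in> \<Gamma>"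
begin

lemma matpow_mem: "A \<in> \<Gamma> \<Longrightarrow> matpow A n \<in> \<Gamma>"
  by (induction n) (auto simp: one_mem mult_mem)

text \<open>The Lie algebra of the closure of \<open>\<Gamma>\<close>.  Fixing the rate \<open>1 / n\<close> of convergence makes it a
  linear space without recourse to the exponential map.\<close>

definition tangent :: "(real^2^2) set" where
  "tangent = {X. \<exists>A. (\<forall>n. A n \<in> \<Gamma>) \<and> (\<lambda>n. real n *\<^sub>R (A n - mat 1)) \<longlonglongrightarrow> X}"

lemma tangentI:
  "(\<And>n. A n \<in> \<Gamma>) \<Longrightarrow> (\<lambda>n. real n *\<^sub>R (A n - mat 1)) \<longlonglongrightarrow> X \<Longrightarrow> X \<in> tangent"
  unfolding tangent_def by blast

lemma tangentE:
  assumes "X \<in> tangent"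
  obtains A where "\<And>n. A n \<in> \<Gamma>" "(\<lambda>n. real n *\<^sub>R (A n - mat 1)) \<longlonglongrightarrow> X" "A \<longlonglongrightarrow> mat 1"
proof -
  obtain A where A: "\<And>n. A n \<in> \<Gamma>" "(\<lambda>n. real n *\<^sub>R (A n - mat 1)) \<longlonglongrightarrow> X"
    using assms unfolding tangent_def by blast
  have "(\<lambda>n. (1 / real n) *\<^sub>R (real n *\<^sub>R (A n - mat 1))) \<longlonglongrightarrow> 0 *\<^sub>R X"
    by (intro tendsto_scaleR A lim_1_over_n)
  moreover have "\<forall>\<^sub>F n in sequentially. (1 / real n) *\<^sub>R (real n *\<^sub>R (A n - mat 1)) = A n - mat 1"
    using eventually_gt_at_top[of 0] by eventually_elim simp
  ultimately have "(\<lambda>n. A n - mat 1) \<longlonglongrightarrow> 0"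
    by (simp add: tendsto_cong)
  then have "A \<longlonglongrightarrow> mat 1" by (simp add: LIM_zero_iff)
  with A that show thesis by blast
qed

text \<open>For A_n = I + E_n of determinant one, tr E_n = - det E_n. After scaling by n, each
  product in the determinant has one convergent factor and one factor tending to 0.\<close>

lemma tangent_trace:
  assumes "X \<in> tangent"
  shows "X$2$2 = - X$1$1"
proof -
  obtain A where A: "\<And>n. A n \<in> \<Gamma>" "(\<lambda>n. real n *\<^sub>R (A n - mat 1)) \<longlonglongrightarrow> X" "A \<longlonglongrightarrow> mat 1"
    by (rule tangentE[OF assms]) (rule that)
  have N: "(\<lambda>n. (real n *\<^sub>R (A n - mat 1))$i$j) \<longlonglongrightarrow> X$i$j" for i j
    by (intro tendsto_intros A)
  have "(\<lambda>n. (real n *\<^sub>R (A n - mat 1))$1$2 * A n$2$1 - (real n *\<^sub>R (A n - mat 1))$1$1 * (A n$2$2 - 1))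
      \<longlonglongrightarrow> X$1$2 * (mat 1 :: real^2^2)$2$1 - X$1$1 * ((mat 1 :: real^2^2)$2$2 - 1)"
    by (intro tendsto_diff tendsto_mult N tendsto_vec_nth A(3) tendsto_const)
  moreover have "(\<lambda>n. (real n *\<^sub>R (A n - mat 1))$1$2 * A n$2$1 - (real n *\<^sub>R (A n - mat 1))$1$1 * (A n$2$2 - 1))
     = (\<lambda>n. (real n *\<^sub>R (A n - mat 1))$1$1 + (real n *\<^sub>R (A n - mat 1))$2$2)"
  proof
    fix n
    have "A n$1$1 * A n$2$2 - A n$1$2 * A n$2$1 = 1"
      using det_one[OF A(1)] by (simp add: det_2)
    then have "A n$1$2 * A n$2$1 = A n$1$1 * A n$2$2 - 1" by simp
    then have "real n * (A n$1$2 * A n$2$1) = real n * (A n$1$1 * A n$2$2 - 1)" by simp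
    then show "(real n *\<^sub>R (A n - mat 1))$1$2 * A n$2$1 - (real n *\<^sub>R (A n - mat 1))$1$1 * (A n$2$2 - 1)
     = (real n *\<^sub>R (A n - mat 1))$1$1 + (real n *\<^sub>R (A n - mat 1))$2$2"
      by (simp add: mat_nth algebra_simps)
  qed
  ultimately have "(\<lambda>n. (real n *\<^sub>R (A n - mat 1))$1$1 + (real n *\<^sub>R (A n - mat 1))$2$2) \<longlonglongrightarrow> 0"
    by (simp add: mat_nth)
  moreover have "(\<lambda>n. (real n *\<^sub>R (A n - mat 1))$1$1 + (real n *\<^sub>R (A n - mat 1))$2$2) \<longlonglongrightarrow> X$1$1 + X$2$2"
    by (intro tendsto_add N)
  ultimately have "X$1$1 + X$2$2 = 0"
    using LIMSEQ_unique by blast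
  then show ?thesis by simp
qed

lemma tangent_zero: "0 \<in> tangent"
  by (rule tangentI[of "\<lambda>_. mat 1"]) (simp_all add: one_mem)

text \<open>A B - I = (A - I) B + (B - I), and B_n tends to I.\<close>

lemma tangent_add:
  assumes "X \<in> tangent" "Y \<in> tangent"
  shows "X + Y \<in> tangent"
proof -
  obtain A where A: "\<And>n. A n \<in> \<Gamma>" "(\<lambda>n. real n *\<^sub>R (A n - mat 1)) \<longlonglongrightarrow> X" "A \<longlonglongrightarrow> mat 1"
    by (rule tangentE[OF assms(1)]) (rule that)
  obtain B where B: "\<And>n. B n \<in> \<Gamma>" "(\<lambda>n. real n *\<^sub>R (B n - mat 1)) \<longlonglongrightarrow> Y" "B \<longlonglongrightarrow> mat 1"
    by (rule tangentE[OF assms(2)]) (rule that)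
  have "(\<lambda>n. (real n *\<^sub>R (A n - mat 1)) ** B n + real n *\<^sub>R (B n - mat 1)) \<longlonglongrightarrow> X ** mat 1 + Y"
    by (intro tendsto_add tendsto_matrix_mult A B)
  moreover have "(real n *\<^sub>R (A n - mat 1)) ** B n + real n *\<^sub>R (B n - mat 1) = real n *\<^sub>R (A n ** B n - mat 1)" for n
    by (simp add: matrix_distribs algebra_simps)
  ultimately show ?thesis
    by (intro tangentI[of "\<lambda>n. A n ** B n"]) (simp_all add: mult_mem A B)
qed

text \<open>The inverse A' of A satisfies A' - I = - A' (A - I), and A'_n tends to I.\<close>

lemma tangent_uminus:
  assumes "X \<in> tangent"
  shows "- X \<in> tangent"
proof -
  obtain A where A: "\<And>n. A n \<in> \<Gamma>" "(\<lambda>n. real n *\<^sub>R (A n - mat 1)) \<longlonglongrightarrow> X" "A \<longlonglongrightarrow> mat 1"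
    by (rule tangentE[OF assms]) (rule that)
  have A': "(\<lambda>n. adj2 (A n)) \<longlonglongrightarrow> mat 1"
  proof (intro vec_tendstoI)
    fix i j
    have "(\<lambda>n. A n $ k $ l) \<longlonglongrightarrow> mat 1 $ k $ l" for k l by (intro tendsto_vec_nth A)
    from this[of 1 1] this[of 2 2] tendsto_minus[OF this[of 1 2]] tendsto_minus[OF this[of 2 1]]
    show "(\<lambda>n. adj2 (A n) $ i $ j) \<longlonglongrightarrow> mat 1 $ i $ j"
      using exhaust_2[of i] exhaust_2[of j] by (auto simp: adj2_def mat_nth)
  qed
  have "(\<lambda>n. - (adj2 (A n) ** (real n *\<^sub>R (A n - mat 1)))) \<longlonglongrightarrow> - (mat 1 ** X)"
    by (intro tendsto_minus tendsto_matrix_mult A A')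
  moreover have "- (adj2 (A n) ** (real n *\<^sub>R (A n - mat 1))) = real n *\<^sub>R (adj2 (A n) - mat 1)" for n
    by (simp add: matrix_distribs mult_adj2 det_one A(1) algebra_simps)
  ultimately show ?thesis
    by (intro tangentI[of "\<lambda>n. adj2 (A n)"]) (simp_all add: adj2_mem A)
qed

text \<open>The sequence is reindexed by m(n) close to n/s: then n (A_m - I) = (n/m) m (A_m - I),
  and n/m tends to s.\<close>

lemma tangent_scale_pos:
  assumes "X \<in> tangent" "s > 0"
  shows "s *\<^sub>R X \<in> tangent"
proof -
  obtain A where A: "\<And>n. A n \<in> \<Gamma>" "(\<lambda>n. real n *\<^sub>R (A n - mat 1)) \<longlonglongrightarrow> X" "A \<longlonglongrightarrow> mat 1"
    by (rule tangentE[OF assms(1)]) (rule that)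
  define m where "m n = nat \<lceil>real n / s\<rceil>" for n
  have m1: "real n / s \<le> real (m n)" "real (m n) \<le> real n / s + 1" for n
    unfolding m_def using assms(2) by (auto simp: of_nat_nat real_nat_ceiling_ge)
  have lim_m: "filterlim m sequentially sequentially"
    unfolding filterlim_at_top
  proof
    fix Z
    show "\<forall>\<^sub>F n in sequentially. Z \<le> m n"
      using eventually_ge_at_top[of "nat \<lceil>s * real Z\<rceil>"]
    proof eventually_elim
      case (elim n)
      then have "s * real Z \<le> real n" by linarith
      then have "real Z \<le> real n / s" using assms(2) by (simp add: field_simps)
      then show ?case using m1(1)[of n] by linarith
    qed
  qed
  have "(\<lambda>n. real (m n) / real n) \<longlonglongrightarrow> 1 / s"
  proof (rule tendsto_sandwich)
    show "\<forall>\<^sub>F n in sequentially. 1 / s \<le> real (m n) / real n"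
      using eventually_gt_at_top[of 0]
    proof eventually_elim
      case (elim n)
      then show ?case using m1(1)[of n] by (simp add: field_simps)
    qed
    show "\<forall>\<^sub>F n in sequentially. real (m n) / real n \<le> 1 / s + 1 / real n"
      using eventually_gt_at_top[of 0]
    proof eventually_elim
      case (elim n)
      then have "real (m n) / real n \<le> (real n / s + 1) / real n"
        using m1(2)[of n] by (intro divide_right_mono) auto
      then show ?case using elim by (simp add: add_divide_distrib)
    qed
    have "(\<lambda>n. 1 / s + 1 / real n) \<longlonglongrightarrow> 1 / s + 0"
      by (intro tendsto_intros lim_1_over_n)
    then show "(\<lambda>n. 1 / s + 1 / real n) \<longlonglongrightarrow> 1 / s" by simp
  qed simp
  then have "(\<lambda>n. inverse (real (m n) / real n)) \<longlonglongrightarrow> inverse (1 / s)"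
    using assms(2) by (intro tendsto_inverse) auto
  then have ratio: "(\<lambda>n. real n / real (m n)) \<longlonglongrightarrow> s"
    by (simp add: inverse_eq_divide)
  have "(\<lambda>n. (real n / real (m n)) *\<^sub>R (real (m n) *\<^sub>R (A (m n) - mat 1))) \<longlonglongrightarrow> s *\<^sub>R X"
    by (intro tendsto_scaleR ratio filterlim_compose[OF A(2) lim_m])
  moreover have "\<forall>\<^sub>F n in sequentially. (real n / real (m n)) *\<^sub>R (real (m n) *\<^sub>R (A (m n) - mat 1))
      = real n *\<^sub>R (A (m n) - mat 1)"
    using lim_m[unfolded filterlim_at_top, rule_format, of 1]
    by eventually_elim simp
  ultimately have "(\<lambda>n. real n *\<^sub>R (A (m n) - mat 1)) \<longlonglongrightarrow> s *\<^sub>R X"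
    by (rule Lim_transform_eventually)
  then show ?thesis by (intro tangentI[of "\<lambda>n. A (m n)"]) (simp_all add: A)
qed

lemma subspace_tangent: "subspace tangent"
  unfolding subspace_def
proof (intro conjI ballI allI tangent_zero tangent_add)
  fix X and c :: real assume X: "X \<in> tangent"
  consider "c > 0" | "c = 0" | "- c > 0" by linarith
  then show "c *\<^sub>R X \<in> tangent"
  proof cases
    case 3
    from tangent_uminus[OF tangent_scale_pos[OF X 3]] show ?thesis by simp
  qed (use tangent_zero tangent_scale_pos[OF X] in auto)
qed

lemma tangent_conj:
  assumes "X \<in> tangent" "M \<in> \<Gamma>"
  shows "M ** X ** adj2 M \<in> tangent"
proof -
  obtain A where A: "\<And>n. A n \<in> \<Gamma>" "(\<lambda>n. real n *\<^sub>R (A n - mat 1)) \<longlonglongrightarrow> X" "A \<longlonglongrightarrow> mat 1"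
    by (rule tangentE[OF assms(1)]) (rule that)
  have "(\<lambda>n. M ** (real n *\<^sub>R (A n - mat 1)) ** adj2 M) \<longlonglongrightarrow> M ** X ** adj2 M"
    by (intro tendsto_matrix_mult tendsto_const A)
  moreover have "M ** (real n *\<^sub>R (A n - mat 1)) ** adj2 M = real n *\<^sub>R (M ** A n ** adj2 M - mat 1)" for n
    by (simp add: matrix_distribs mult_adj2 det_one assms(2))
  ultimately show ?thesis
    by (intro tangentI[of "\<lambda>n. M ** A n ** adj2 M"]) (simp_all add: A mult_mem adj2_mem assms(2))
qed

text \<open>Small elements \<open>I + E\<close> of \<open>\<Gamma>\<close> have powers \<open>(I + E)\<^sup>m\<close> close to \<open>I + m E\<close> with \<open>m \<bar>E\<bar>\<close> close to
  \<open>1 / n\<close>, so any limit of the directions \<open>E / \<bar>E\<bar>\<close> is tangent.\<close>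

lemma tangent_nonzero:
  assumes small: "\<And>e. e > 0 \<Longrightarrow> \<exists>A\<in>\<Gamma>. A \<noteq> mat 1 \<and> norm (A - mat 1) < e"
  shows "\<exists>X\<in>tangent. X \<noteq> 0"
proof -
  \<comment> \<open>Smallness of order 1/n^2 makes the rounding in the exponent \<open>m n\<close>
    below harmless: its relative effect is n * \<open>e n\<close> \<le> 1/n.\<close>
  have "\<exists>A\<in>\<Gamma>. A \<noteq> mat 1 \<and> norm (A - mat 1) < 1 / (real (Suc n))\<^sup>2" for n
    by (rule small) simp
  then obtain A where A: "\<And>n. A n \<in> \<Gamma>" "\<And>n. A n \<noteq> mat 1"
      and A_small: "\<And>n. norm (A n - mat 1) < 1 / (real (Suc n))\<^sup>2"
    by metis
  define U where "U n = (1 / norm (A n - mat 1)) *\<^sub>R (A n - mat 1)" for n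
  have U: "U n \<in> sphere 0 1" for n
    using A(2)[of n] by (simp add: U_def)
  obtain X r where X: "X \<in> sphere 0 1" and r: "strict_mono r" and lim: "(U \<circ> r) \<longlonglongrightarrow> X"
    using compact_sphere[of "0 :: real^2^2" 1] U unfolding compact_def by blast
  define e where "e n = norm (A (r n) - mat 1)" for n
  \<comment> \<open>The power \<open>m n\<close> brings the displacement from \<open>e n\<close> up
    to about 1/n, the rate that \<open>tangent\<close> prescribes. The quadratic error is then of
    order 1/n^2, negligible after scaling by n.\<close>
  define m where "m n = nat \<lfloor>1 / (real n * e n)\<rfloor>" for n
  have e_pos: "e n > 0" for n using A(2)[of "r n"] by (simp add: e_def)
  have ne: "real n * e n \<le> 1 / real n" if "n > 0" for n
  proof -
    have "real n \<le> real (Suc (r n))" using seq_suble[OF r, of n] by simp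
    then have "1 / (real (Suc (r n)))\<^sup>2 \<le> 1 / (real n)\<^sup>2"
      using that by (intro divide_left_mono power_mono) auto
    then have "e n \<le> 1 / (real n)\<^sup>2"
      using A_small[of "r n"] unfolding e_def by linarith
    then have "real n * e n \<le> real n * (1 / (real n)\<^sup>2)"
      by (intro mult_left_mono) auto
    then show ?thesis using that by (simp add: power2_eq_square)
  qed
  have m_le: "real (m n) * e n \<le> 1 / real n" and m_ge: "1 - 1 / real n \<le> real n * (real (m n) * e n)"
    if n: "n > 0" for n
  proof -
    have p: "real n * e n > 0" using n e_pos by simp
    have "real (m n) \<le> 1 / (real n * e n)"
      unfolding m_def using p by (simp add: of_nat_nat)
    then have "real (m n) * e n \<le> 1 / (real n * e n) * e n"
      using e_pos[of n] by (intro mult_right_mono) auto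
    then show "real (m n) * e n \<le> 1 / real n" using e_pos[of n] by simp
    have "1 / (real n * e n) - 1 \<le> real (m n)"
      unfolding m_def using p by linarith
    then have "(1 / (real n * e n) - 1) * (real n * e n) \<le> real (m n) * (real n * e n)"
      using p by (intro mult_right_mono) auto
    moreover have "(1 / (real n * e n) - 1) * (real n * e n) = 1 - real n * e n"
      using n e_pos[of n] by (simp add: left_diff_distrib)
    ultimately show "1 - 1 / real n \<le> real n * (real (m n) * e n)"
      using ne[OF n] by (simp add: mult_ac)
  qed
  have c: "(\<lambda>n. real n * (real (m n) * e n)) \<longlonglongrightarrow> 1"
  proof (rule tendsto_sandwich)
    show "\<forall>\<^sub>F n in sequentially. 1 - 1 / real n \<le> real n * (real (m n) * e n)"
      using eventually_gt_at_top[of 0] by eventually_elim (rule m_ge)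
    show "\<forall>\<^sub>F n in sequentially. real n * (real (m n) * e n) \<le> 1"
      using eventually_gt_at_top[of 0]
    proof eventually_elim
      case (elim n)
      then show ?case using mult_left_mono[OF m_le[OF elim], of "real n"] by simp
    qed
    have "(\<lambda>n. 1 - 1 / real n) \<longlonglongrightarrow> 1 - 0" by (intro tendsto_intros lim_1_over_n)
    then show "(\<lambda>n. 1 - 1 / real n) \<longlonglongrightarrow> 1" by simp
  qed simp
  define R where "R n = matpow (A (r n)) (m n) - mat 1 - real (m n) *\<^sub>R (A (r n) - mat 1)" for n
  have "(\<lambda>n. real n *\<^sub>R R n) \<longlonglongrightarrow> 0"
  proof (rule Lim_null_comparison)
    show "\<forall>\<^sub>F n in sequentially. norm (real n *\<^sub>R R n) \<le> 1 / real n"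
      using eventually_gt_at_top[of 0]
    proof eventually_elim
      case (elim n)
      have le: "real (m n) * norm (A (r n) - mat 1) \<le> 1 / real n"
        using m_le[OF elim] by (simp add: e_def)
      moreover have "1 / real n \<le> 1" using elim by simp
      ultimately have "norm (R n) \<le> (real (m n) * norm (A (r n) - mat 1))\<^sup>2"
        unfolding R_def by (intro norm_matpow_quadratic_approx_le) linarith
      also have "\<dots> \<le> (1 / real n)\<^sup>2" using le by (intro power_mono) auto
      finally have "real n * norm (R n) \<le> real n * (1 / real n)\<^sup>2"
        by (intro mult_left_mono) auto
      then show ?case using elim by (simp add: power2_eq_square)
    qed
  qed (rule lim_1_over_n)
  then have "(\<lambda>n. (real n * (real (m n) * e n)) *\<^sub>R (U \<circ> r) n + real n *\<^sub>R R n) \<longlonglongrightarrow> 1 *\<^sub>R X + 0"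
    by (intro tendsto_add tendsto_scaleR c lim)
  moreover have "(real n * (real (m n) * e n)) *\<^sub>R (U \<circ> r) n + real n *\<^sub>R R n
      = real n *\<^sub>R (matpow (A (r n)) (m n) - mat 1)" for n
    using e_pos[of n] by (simp add: R_def U_def e_def algebra_simps)
  ultimately have "X \<in> tangent"
    by (intro tangentI[of "\<lambda>n. matpow (A (r n)) (m n)"]) (simp_all add: A matpow_mem)
  with X show ?thesis by (intro bexI[of _ X]) auto
qed

lemma closure_mult_mem:
  assumes "A \<in> closure \<Gamma>" "B \<in> closure \<Gamma>"
  shows "A ** B \<in> closure \<Gamma>"
proof -
  obtain a b where "\<And>n. a n \<in> \<Gamma>" "a \<longlonglongrightarrow> A" "\<And>n. b n \<in> \<Gamma>" "b \<longlonglongrightarrow> B"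
    using assms unfolding closure_sequential by blast
  then show ?thesis unfolding closure_sequential
    by (intro exI[of _ "\<lambda>n. a n ** b n"]) (auto intro: mult_mem tendsto_matrix_mult)
qed

lemma one_plus_nilpotent_mem_closure:
  assumes "X \<in> tangent" "X ** X = 0"
  shows "mat 1 + X \<in> closure \<Gamma>"
proof -
  obtain A where A: "\<And>n. A n \<in> \<Gamma>" "(\<lambda>n. real n *\<^sub>R (A n - mat 1)) \<longlonglongrightarrow> X" "A \<longlonglongrightarrow> mat 1"
    by (rule tangentE[OF assms(1)]) (rule that)
  from tendsto_matpow_nilpotent[OF A(2) assms(2)] show ?thesis
    unfolding closure_sequential using A(1) matpow_mem by (intro exI[of _ "\<lambda>n. matpow (A n) n"]) auto
qed

text \<open>Both kinds of unipotent elementary matrices are limits of elements of \<Gamma>, and they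
  generate SL(2,\<real>).\<close>

lemma SL2_subset_closure:
  assumes full: "{X. X$2$2 = - X$1$1} \<subseteq> tangent"
  shows "{A. det A = 1} \<subseteq> closure \<Gamma>"
proof -
  have "mat 1 + mat2 0 t 0 0 \<in> closure \<Gamma>" "mat 1 + mat2 0 0 t 0 \<in> closure \<Gamma>" for t
    by (rule one_plus_nilpotent_mem_closure; use full in \<open>force simp: matrix_simps_2\<close>)+
  moreover have "mat 1 + mat2 0 t 0 0 = mat2 1 t 0 1" "mat 1 + mat2 0 0 t 0 = mat2 1 0 t 1" for t
    by (simp_all add: matrix_simps_2)
  ultimately have U: "mat2 1 t 0 1 \<in> closure \<Gamma>" and L: "mat2 1 0 t 1 \<in> closure \<Gamma>" for t
    by auto
  have c: "A \<in> closure \<Gamma>" if "det A = 1" "A$2$1 \<noteq> 0" for A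
  proof -
    \<comment> \<open>Upper-lower-upper factorisation. The outer parameters are forced by the
      diagonal entries, and determinant one settles the remaining entry.\<close>
    have "A = mat2 1 ((A$1$1 - 1) / A$2$1) 0 1 ** mat2 1 0 (A$2$1) 1 ** mat2 1 ((A$2$2 - 1) / A$2$1) 0 1"
      using that by (simp add: matrix_simps_2 det_2 divide_simps) (simp add: algebra_simps)
    then show ?thesis using closure_mult_mem U L by metis
  qed
  show ?thesis
  proof clarify
    fix A :: "real^2^2" assume A: "det A = 1"
    show "A \<in> closure \<Gamma>"
    proof (cases "A$2$1 = 0")
      case True
      \<comment> \<open>A row operation moves \<open>A$1$1\<close>, which is nonzero here, into the
        lower left corner.\<close>
      have "mat2 1 0 1 1 ** A \<in> closure \<Gamma>"
        using A True by (intro c) (auto simp: det_mul matrix_mult_nth_2 det_2 algebra_simps)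
      then have "mat2 1 0 (- 1) 1 ** (mat2 1 0 1 1 ** A) \<in> closure \<Gamma>"
        by (rule closure_mult_mem[OF L])
      moreover have "mat2 1 0 (- 1) 1 ** (mat2 1 0 1 1 ** A) = A"
        by (simp add: matrix_simps_2)
      ultimately show ?thesis by (simp only:)
    qed (use c A in blast)
  qed
qed

end

section \<open>Linear algebra of the three-dimensional space of traceless matrices\<close>

definition bracket :: "real^2^2 \<Rightarrow> real^2^2 \<Rightarrow> real^2^2" where
  "bracket X Y = X ** Y - Y ** X"

lemma bracket_lincomb:
  "bracket (a *\<^sub>R X + b *\<^sub>R Y) (c *\<^sub>R X + d *\<^sub>R Y) = (a * d - b * c) *\<^sub>R bracket X Y"
  by (simp add: bracket_def matrix_distribs algebra_simps)

text \<open>In the coordinates (X11, X12, X21) the bracket is, up to order and constant factors, the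
  cross product; its vanishing therefore means linear dependence.\<close>

lemma bracket_nth:
  assumes "X$2$2 = - X$1$1" "Y$2$2 = - Y$1$1"
  shows "bracket X Y $1$1 = X$1$2 * Y$2$1 - Y$1$2 * X$2$1"
    "bracket X Y $1$2 = 2 * (X$1$1 * Y$1$2 - Y$1$1 * X$1$2)"
    "bracket X Y $2$1 = 2 * (X$2$1 * Y$1$1 - Y$2$1 * X$1$1)"
    "bracket X Y $2$2 = - bracket X Y $1$1"
  using assms by (simp_all add: bracket_def matrix_mult_nth_2 algebra_simps)

lemma bracket_eq_0_imp_scaleR:
  assumes "X$2$2 = - X$1$1" "Y$2$2 = - Y$1$1" "bracket X Y = 0" "X \<noteq> 0"
  shows "\<exists>c. Y = c *\<^sub>R X"
proof -
  have e: "X$1$2 * Y$2$1 = Y$1$2 * X$2$1" "X$1$1 * Y$1$2 = Y$1$1 * X$1$2" "X$2$1 * Y$1$1 = Y$2$1 * X$1$1"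
    using bracket_nth[OF assms(1,2)] assms(3) by auto
  consider "X$1$1 \<noteq> 0" | "X$1$2 \<noteq> 0" | "X$2$1 \<noteq> 0"
    using assms(1,4) by (auto simp: matrix_eq_2)
  then show ?thesis
  proof cases
    case 1
    with e assms(1,2) show ?thesis
      by (intro exI[of _ "Y$1$1 / X$1$1"]) (simp add: matrix_eq_2 field_simps)
  next
    case 2
    with e assms(1,2) show ?thesis
      by (intro exI[of _ "Y$1$2 / X$1$2"]) (simp add: matrix_eq_2 field_simps)
  next
    case 3
    with e assms(1,2) show ?thesis
      by (intro exI[of _ "Y$2$1 / X$2$1"]) (simp add: matrix_eq_2 field_simps)
  qed
qed

text \<open>The determinant of the coordinates of three traceless matrices.\<close>

definition triple :: "real^2^2 \<Rightarrow> real^2^2 \<Rightarrow> real^2^2 \<Rightarrow> real" where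
  "triple X Y Z = (X$1$2 * Y$2$1 - Y$1$2 * X$2$1) * Z$1$1
     + (X$2$1 * Y$1$1 - Y$2$1 * X$1$1) * Z$1$2 + (X$1$1 * Y$1$2 - Y$1$1 * X$1$2) * Z$2$1"

lemma triple_cramer:
  assumes "X$2$2 = - X$1$1" "Y$2$2 = - Y$1$1" "Z$2$2 = - Z$1$1" "W$2$2 = - W$1$1"
  shows "triple X Y Z *\<^sub>R W = triple W Y Z *\<^sub>R X + triple X W Z *\<^sub>R Y + triple X Y W *\<^sub>R Z"
  using assms unfolding triple_def matrix_eq_2 by (simp add: algebra_simps)

text \<open>A nonzero entry of the bracket selects a coordinate matrix Z completing X, Y to a basis.
  In Cramer's rule the coefficient of Z is \<open>triple X Y W\<close>, which vanishes.\<close>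

lemma triple_eq_0_imp_lincomb:
  assumes tr: "X$2$2 = - X$1$1" "Y$2$2 = - Y$1$1" "W$2$2 = - W$1$1"
    and "triple X Y W = 0" "bracket X Y \<noteq> 0"
  shows "\<exists>a b. W = a *\<^sub>R X + b *\<^sub>R Y"
proof -
  obtain Z where Z: "Z$2$2 = - Z$1$1" "triple X Y Z \<noteq> 0"
  proof -
    consider "bracket X Y $1$1 \<noteq> 0" | "bracket X Y $1$2 \<noteq> 0" | "bracket X Y $2$1 \<noteq> 0"
      using assms(5) bracket_nth(4)[OF tr(1,2)] by (auto simp: matrix_eq_2)
    then show thesis
    proof cases
      case 1
      then show ?thesis
        by (intro that[of "mat2 1 0 0 (- 1)"]) (auto simp: triple_def bracket_nth[OF tr(1,2)])
    next
      case 2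
      then show ?thesis
        by (intro that[of "mat2 0 0 1 0"]) (auto simp: triple_def bracket_nth[OF tr(1,2)])
    next
      case 3
      then show ?thesis
        by (intro that[of "mat2 0 1 0 0"]) (auto simp: triple_def bracket_nth[OF tr(1,2)])
    qed
  qed
  have "triple X Y Z *\<^sub>R W = triple W Y Z *\<^sub>R X + triple X W Z *\<^sub>R Y"
    using triple_cramer[OF tr(1,2) Z(1) tr(3)] assms(4) by simp
  then have "(1 / triple X Y Z) *\<^sub>R (triple X Y Z *\<^sub>R W)
      = (1 / triple X Y Z) *\<^sub>R (triple W Y Z *\<^sub>R X + triple X W Z *\<^sub>R Y)"
    by (simp only:)
  then have "W = (triple W Y Z / triple X Y Z) *\<^sub>R X + (triple X W Z / triple X Y Z) *\<^sub>R Y"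
    using Z(2) by (simp add: scaleR_add_right)
  then show ?thesis by blast
qed

context SL2_subgroup
begin

lemma conj_cancel:
  assumes "M \<in> \<Gamma>" "M ** X ** adj2 M = Y"
  shows "M ** X = Y ** M"
proof -
  have "Y ** M = M ** X ** (adj2 M ** M)"
    by (simp add: assms(2)[symmetric] matrix_mul_assoc)
  then show ?thesis by (simp add: mult_adj2 det_one assms(1))
qed

text \<open>The tangent space is invariant under conjugation.  If it is a line, a generator is a common
  eigenvector; if it is a plane, the commutator of two generators is.\<close>

lemma tangent_full_or_common_eigenvector:
  assumes "\<exists>X\<in>tangent. X \<noteq> 0"
  shows "{X. X$2$2 = - X$1$1} \<subseteq> tangent \<or>
    (\<exists>X. X \<noteq> 0 \<and> X$2$2 = - X$1$1 \<and> (\<forall>M\<in>\<Gamma>. \<exists>c. M ** X = c *\<^sub>R (X ** M)))"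
proof -
  obtain X where X: "X \<in> tangent" "X \<noteq> 0" using assms by blast
  show ?thesis
  proof (cases "\<exists>Y\<in>tangent. \<exists>Z\<in>tangent. triple X Y Z \<noteq> 0")
    case True
    then obtain Y Z where YZ: "Y \<in> tangent" "Z \<in> tangent" "triple X Y Z \<noteq> 0" by blast
    have "W \<in> tangent" if W: "W$2$2 = - W$1$1" for W
    proof -
      have "(1 / triple X Y Z) *\<^sub>R (triple W Y Z *\<^sub>R X + triple X W Z *\<^sub>R Y + triple X Y W *\<^sub>R Z) \<in> tangent"
        using X YZ by (intro subspace_scale subspace_add subspace_tangent)
      also have "triple W Y Z *\<^sub>R X + triple X W Z *\<^sub>R Y + triple X Y W *\<^sub>R Z = triple X Y Z *\<^sub>R W"
        using triple_cramer[of X Y Z W] W X YZ tangent_trace by simp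
      finally show ?thesis using YZ(3) by simp
    qed
    then show ?thesis by blast
  next
    case False
    \<comment> \<open>All triple products with X vanish, so the tangent space is a plane spanned by
      X and any Y not commuting with X, or else the line through X.\<close>
    have "\<exists>X. X \<noteq> 0 \<and> X$2$2 = - X$1$1 \<and> (\<forall>M\<in>\<Gamma>. \<exists>c. M ** X = c *\<^sub>R (X ** M))"
    proof (cases "\<exists>Y\<in>tangent. bracket X Y \<noteq> 0")
      case True
      then obtain Y where Y: "Y \<in> tangent" "bracket X Y \<noteq> 0" by blast
      have span: "\<exists>a b. W = a *\<^sub>R X + b *\<^sub>R Y" if "W \<in> tangent" for W
        using False X Y that tangent_trace by (intro triple_eq_0_imp_lincomb) auto
      have "\<exists>c. M ** bracket X Y = c *\<^sub>R (bracket X Y ** M)" if M: "M \<in> \<Gamma>" for M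
      proof -
        obtain a b where ab: "M ** X ** adj2 M = a *\<^sub>R X + b *\<^sub>R Y"
          using span[OF tangent_conj[OF X(1) M]] by blast
        obtain c d where cd: "M ** Y ** adj2 M = c *\<^sub>R X + d *\<^sub>R Y"
          using span[OF tangent_conj[OF Y(1) M]] by blast
        \<comment> \<open>Conjugation by M acts on the plane with coefficients a, b, c, d. The
          bracket is bilinear and alternating, so it is multiplied by a d - b c.\<close>
        note m = conj_cancel[OF M ab] conj_cancel[OF M cd]
        have "M ** bracket X Y = M ** X ** Y - M ** Y ** X"
          by (simp add: bracket_def matrix_distribs matrix_mul_assoc)
        also have "\<dots> = (a *\<^sub>R X + b *\<^sub>R Y) ** (M ** Y) - (c *\<^sub>R X + d *\<^sub>R Y) ** (M ** X)"
          by (simp only: m[symmetric] matrix_mul_assoc)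
        also have "\<dots> = bracket (a *\<^sub>R X + b *\<^sub>R Y) (c *\<^sub>R X + d *\<^sub>R Y) ** M"
          unfolding m by (simp only: bracket_def matrix_distribs matrix_mul_assoc)
        also have "\<dots> = (a * d - b * c) *\<^sub>R (bracket X Y ** M)"
          by (simp only: bracket_lincomb matrix_scaleR_mult_left)
        finally show ?thesis by blast
      qed
      then show ?thesis
        using Y bracket_nth(4)[OF tangent_trace[OF X(1)] tangent_trace[OF Y(1)]] by blast
    next
      case False
      have "\<exists>c. M ** X = c *\<^sub>R (X ** M)" if M: "M \<in> \<Gamma>" for M
      proof -
        have "\<exists>c. M ** X ** adj2 M = c *\<^sub>R X"
          using False X tangent_conj[OF X(1) M] tangent_trace
          by (intro bracket_eq_0_imp_scaleR) auto
        then show ?thesis using conj_cancel[OF M] by (metis matrix_scaleR_mult_left)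
      qed
      then show ?thesis using X tangent_trace by blast
    qed
    then show ?thesis ..
  qed
qed

lemma dense_or_common_eigenvector:
  assumes "\<And>e. e > 0 \<Longrightarrow> \<exists>A\<in>\<Gamma>. A \<noteq> mat 1 \<and> norm (A - mat 1) < e"
  shows "{A. det A = 1} \<subseteq> closure \<Gamma> \<or>
    (\<exists>X. X \<noteq> 0 \<and> X$2$2 = - X$1$1 \<and> (\<forall>M\<in>\<Gamma>. \<exists>c. M ** X = c *\<^sub>R (X ** M)))"
  using tangent_full_or_common_eigenvector[OF tangent_nonzero[OF assms]] SL2_subset_closure by blast

end

section \<open>The circle as a projective line\<close>

text \<open>The Cayley map in homogeneous coordinates: for w = v1/v2 this is (w - \<i>) / (w +
  \<i>), and [1 : 0], that is infinity, goes to 1. It identifies the real projective line with the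
  circle.\<close>

definition circle_pt :: "real^2 \<Rightarrow> complex" where
  "circle_pt v = Complex (v$1) (- v$2) / Complex (v$1) (v$2)"

definition wedge :: "real^2 \<Rightarrow> real^2 \<Rightarrow> real" where
  "wedge v w = v$1 * w$2 - v$2 * w$1"

lemma Complex_vec_eq_0_iff [simp]: "Complex (v$1) (v$2) = 0 \<longleftrightarrow> v = (0 :: real^2)"
  by (simp add: complex_eq_iff vec_eq_iff forall_2)

lemma circle_pt_in_sphere: "v \<noteq> 0 \<Longrightarrow> circle_pt v \<in> sphere 0 1"
proof -
  assume "v \<noteq> 0"
  moreover have "cmod (Complex (v$1) (- v$2)) = cmod (Complex (v$1) (v$2))"
    by (simp add: cmod_def)
  ultimately show ?thesis
    by (simp add: circle_pt_def norm_divide del: complex_norm)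
qed

lemma sphere_circle_ptE:
  assumes "p \<in> sphere 0 1"
  obtains v where "v \<noteq> 0" "p = circle_pt v"
proof -
  obtain t where t: "p = cis t"
    using assms by (metis complex_unit_circle norm_eq_1 cis_Arg sgn_eq mem_sphere_0 div_by_1 norm_zero of_real_1 zero_neq_one)
  \<comment> \<open>The quotient of the conjugate of z by z has argument -2 arg z, so the argument
    wanted for z is -t/2.\<close>
  define v :: "real^2" where "v = vector [cos (t / 2), - sin (t / 2)]"
  have "v \<noteq> 0"
    using sin_zero_norm_cos_one[of "t / 2"] by (auto simp: v_def vec_eq_iff forall_2)
  moreover have "circle_pt v = cis (t / 2) / cis (- (t / 2))"
    by (simp add: circle_pt_def v_def cis_conv_exp[symmetric] cis.ctr)
  then have "circle_pt v = p" by (simp add: cis_divide t)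
  ultimately show thesis using that by blast
qed

lemma circle_pt_scaleR: "c \<noteq> 0 \<Longrightarrow> circle_pt (c *\<^sub>R v) = circle_pt v"
proof -
  have "Complex (c * a) (c * b) = of_real c * Complex a b" for a b
    by (simp add: complex_eq_iff)
  from this[of "v$1" "v$2"] this[of "v$1" "- v$2"] show "c \<noteq> 0 \<Longrightarrow> circle_pt (c *\<^sub>R v) = circle_pt v"
    by (simp add: circle_pt_def)
qed

text \<open>Over a common denominator, the numerator is a complex number minus its conjugate, whose
  imaginary part is the wedge. This turns chords of the circle into areas in the plane.\<close>

lemma circle_pt_diff:
  assumes "v \<noteq> 0" "w \<noteq> 0"
  shows "circle_pt w - circle_pt v =
    2 * \<i> * of_real (wedge w v) / (Complex (v$1) (v$2) * Complex (w$1) (w$2))"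
proof -
  have "Complex (w$1) (- w$2) * Complex (v$1) (v$2) - Complex (v$1) (- v$2) * Complex (w$1) (w$2)
      = 2 * \<i> * of_real (wedge w v)"
    by (simp add: complex_eq_iff wedge_def)
  then show ?thesis
    using assms by (simp add: circle_pt_def diff_frac_eq mult.commute)
qed

lemma circle_pt_eq_iff:
  assumes "v \<noteq> 0" "w \<noteq> 0"
  shows "circle_pt v = circle_pt w \<longleftrightarrow> wedge v w = 0"
proof -
  have "circle_pt v = circle_pt w \<longleftrightarrow> circle_pt v - circle_pt w = 0" by simp
  also have "\<dots> \<longleftrightarrow> wedge v w = 0"
    unfolding circle_pt_diff[OF assms(2,1)] using assms by simp
  finally show ?thesis .
qed

lemma wedge_eq_0_scaleR:
  assumes "v \<noteq> 0" "wedge v w = 0"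
  shows "\<exists>c. w = c *\<^sub>R v"
proof -
  consider "v$1 \<noteq> 0" | "v$2 \<noteq> 0" using assms(1) by (auto simp: vec_eq_iff forall_2)
  then show ?thesis
  proof cases
    case 1
    then show ?thesis using assms(2)
      by (intro exI[of _ "w$1 / v$1"]) (simp add: vec_eq_iff forall_2 wedge_def field_simps)
  next
    case 2
    then show ?thesis using assms(2)
      by (intro exI[of _ "w$2 / v$2"]) (simp add: vec_eq_iff forall_2 wedge_def field_simps)
  qed
qed

section \<open>The action on the circle as the linear action on lines\<close>

lemma matrix_vector_nth_2:
  fixes A :: "real^2^2"
  shows "(A *v v) $ i = A$i$1 * v$1 + A$i$2 * v$2"
  by (simp add: matrix_vector_mult_def sum_2)

lemma wedge_mult: "wedge (A *v v) (A *v w) = det A * wedge v w"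
  by (simp add: wedge_def matrix_vector_nth_2 det_2 algebra_simps)

lemma matrix_vector_nonzero:
  fixes A :: "real^2^2"
  assumes "det A \<noteq> 0" "v \<noteq> 0"
  shows "A *v v \<noteq> 0"
  using assms by (metis invertible_det_nz matrix_left_invertible_ker invertible_left_inverse)

text \<open>The homogeneous coordinates \<i> (1 + z) and 1 - z of z = \<open>circle_pt v\<close> are
  v1 and v2 times a common factor k, which cancels in the final quotient.\<close>

lemma SL2R_act_circle_pt:
  assumes "v \<noteq> 0"
  shows "SL2R_act A (circle_pt v) = circle_pt (A *v v)"
proof -
  define D where "D = Complex (v$1) (v$2)"
  have D: "D \<noteq> 0" using assms by (simp add: D_def)
  have D': "Complex (v$1) (- v$2) = 2 * of_real (v$1) - D" "D = of_real (v$1) + \<i> * of_real (v$2)"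
    by (simp_all add: D_def complex_eq_iff)
  define k where "k = 2 * \<i> / D"
  have "k \<noteq> 0" using D by (simp add: k_def)
  have e1: "\<i> * (1 + circle_pt v) = k * of_real (v$1)"
    unfolding circle_pt_def D'(1) D_def[symmetric] k_def using D by (simp add: field_simps)
  have e2: "1 - circle_pt v = k * of_real (v$2)"
  proof -
    have "1 - circle_pt v = (2 * D - 2 * of_real (v$1)) / D"
      unfolding circle_pt_def D'(1) D_def[symmetric] using D by (simp add: field_simps)
    also have "2 * D - 2 * of_real (v$1) = 2 * \<i> * of_real (v$2)"
      by (subst D'(2)) simp
    finally show ?thesis by (simp add: k_def)
  qed
  define u where "u = A *v v"
  have u: "of_real (u$i) = of_real (A$i$1) * of_real (v$1) + of_real (A$i$2) * (of_real (v$2) :: complex)" for i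
    by (simp add: u_def matrix_vector_nth_2)
  have "SL2R_act A (circle_pt v) =
    (k * (of_real (u$1) - \<i> * of_real (u$2))) / (k * (of_real (u$1) + \<i> * of_real (u$2)))"
    unfolding SL2R_act_def Let_def e1 e2 u by (simp add: algebra_simps)
  also have "\<dots> = (of_real (u$1) - \<i> * of_real (u$2)) / (of_real (u$1) + \<i> * of_real (u$2))"
    using \<open>k \<noteq> 0\<close> by simp
  also have "of_real (u$1) - \<i> * of_real (u$2) = Complex (u$1) (- u$2)"
    by (simp add: complex_eq_iff)
  also have "of_real (u$1) + \<i> * of_real (u$2) = Complex (u$1) (u$2)"
    by (simp add: complex_eq_iff)
  finally show ?thesis by (simp add: circle_pt_def u_def)
qed

lemma SL2R_act_in_sphere:
  assumes "det A \<noteq> 0" "p \<in> sphere 0 1"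
  shows "SL2R_act A p \<in> sphere 0 1"
proof -
  obtain v where "v \<noteq> 0" "p = circle_pt v" using sphere_circle_ptE[OF assms(2)] .
  then show ?thesis
    using assms(1) by (simp only: SL2R_act_circle_pt circle_pt_in_sphere matrix_vector_nonzero not_False_eq_True)
qed

lemma SL2R_act_mult:
  assumes "det B \<noteq> 0" "p \<in> sphere 0 1"
  shows "SL2R_act (A ** B) p = SL2R_act A (SL2R_act B p)"
proof -
  obtain v where "v \<noteq> 0" "p = circle_pt v" using sphere_circle_ptE[OF assms(2)] .
  then show ?thesis
    using assms(1) by (simp add: SL2R_act_circle_pt matrix_vector_nonzero matrix_vector_mul_assoc)
qed

lemma SL2R_act_one: "p \<in> sphere 0 1 \<Longrightarrow> SL2R_act (mat 1) p = p"
  by (metis SL2R_act_circle_pt matrix_vector_mul_lid sphere_circle_ptE)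

lemma SL2R_act_scaleR:
  assumes "c \<noteq> 0" "p \<in> sphere 0 1"
  shows "SL2R_act (c *\<^sub>R A) p = SL2R_act A p"
proof -
  obtain v where "v \<noteq> 0" "p = circle_pt v" using sphere_circle_ptE[OF assms(2)] .
  moreover have "(c *\<^sub>R A) *v v = c *\<^sub>R (A *v v)"
    by (simp add: vec_eq_iff forall_2 matrix_vector_nth_2 algebra_simps)
  ultimately show ?thesis
    using assms(1) by (simp add: SL2R_act_circle_pt circle_pt_scaleR)
qed

lemma SL2R_act_eq_iff:
  assumes "det A \<noteq> 0" "p \<in> sphere 0 1" "q \<in> sphere 0 1"
  shows "SL2R_act A p = SL2R_act A q \<longleftrightarrow> p = q"
proof -
  obtain v w where "v \<noteq> 0" "p = circle_pt v" "w \<noteq> 0" "q = circle_pt w"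
    using assms(2,3) by (metis sphere_circle_ptE)
  then show ?thesis
    using assms(1) by (simp add: SL2R_act_circle_pt circle_pt_eq_iff matrix_vector_nonzero wedge_mult)
qed

lemma SL2R_act_transitive:
  assumes "p \<in> sphere 0 1" "q \<in> sphere 0 1"
  shows "\<exists>A. det A = 1 \<and> SL2R_act A p = q"
proof -
  have *: "\<exists>A. det A = 1 \<and> SL2R_act A (circle_pt (vector [1, 0])) = q" if q: "q \<in> sphere 0 1" for q
  proof -
    obtain w where w: "w \<noteq> 0" "q = circle_pt w" using sphere_circle_ptE[OF q] .
    define n where "n = (w$1)\<^sup>2 + (w$2)\<^sup>2"
    have n: "n \<noteq> 0" using w(1) by (auto simp: n_def vec_eq_iff forall_2)
    \<comment> \<open>The second column is w turned by a right angle and divided by its squared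
      length.\<close>
    have "det (mat2 (w$1) (- (w$2) / n) (w$2) (w$1 / n)) = 1"
      using n by (simp add: field_simps) (simp add: n_def power2_eq_square)
    moreover have "mat2 (w$1) (- (w$2) / n) (w$2) (w$1 / n) *v vector [1, 0] = w"
      by (simp add: vec_eq_iff forall_2 matrix_vector_nth_2)
    moreover have "vector [1, 0] \<noteq> (0 :: real^2)"
      by (simp add: vec_eq_iff forall_2)
    ultimately show ?thesis using w by (metis SL2R_act_circle_pt)
  qed
  obtain A B where AB: "det A = 1" "SL2R_act A (circle_pt (vector [1, 0])) = p"
      "det B = 1" "SL2R_act B (circle_pt (vector [1, 0])) = q"
    using * assms by metis
  have e: "circle_pt (vector [1, 0]) \<in> sphere 0 1"
    by (rule circle_pt_in_sphere) (simp add: vec_eq_iff forall_2)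
  have "SL2R_act (adj2 A) p = circle_pt (vector [1, 0])"
    using SL2R_act_mult[OF _ e, of A "adj2 A"] AB by (simp add: mult_adj2 SL2R_act_one[OF e])
  then have "SL2R_act (B ** adj2 A) p = q"
    using AB assms by (simp add: SL2R_act_mult)
  moreover have "det (B ** adj2 A) = 1" using AB by (simp add: det_mul)
  ultimately show ?thesis by blast
qed

text \<open>The quotient C of A by B fixes the lines spanned by (1,0), (0,1) and (1,1), hence is
  scalar, and determinant one leaves the two signs.\<close>

lemma SL2R_act_eq_imp:
  assumes "det A = 1" "det B = 1" "\<And>p. p \<in> sphere 0 1 \<Longrightarrow> SL2R_act A p = SL2R_act B p"
  shows "A = B \<or> A = - B"
proof -
  define C where "C = adj2 B ** A"
  have dC: "det C = 1" using assms by (simp add: C_def det_mul)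
  have A: "A = B ** C" using assms(2) by (simp add: C_def matrix_mul_assoc mult_adj2)
  have fix_pt: "SL2R_act C p = p" if "p \<in> sphere 0 1" for p
  proof -
    have "SL2R_act C p = SL2R_act (adj2 B) (SL2R_act B p)"
      unfolding C_def using assms that by (simp add: SL2R_act_mult)
    also have "\<dots> = p"
      using SL2R_act_mult[of B p "adj2 B"] assms(2) that by (simp add: mult_adj2 SL2R_act_one)
    finally show ?thesis .
  qed
  have w: "wedge (C *v v) v = 0" if "v \<noteq> 0" for v
    using fix_pt[OF circle_pt_in_sphere[OF that]] that dC
    by (simp add: SL2R_act_circle_pt circle_pt_eq_iff matrix_vector_nonzero)
  have "C$2$1 = 0" "C$1$2 = 0" "C$1$1 = C$2$2"
    using w[of "vector [1, 0]"] w[of "vector [0, 1]"] w[of "vector [1, 1]"]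
    by (auto simp: wedge_def matrix_vector_nth_2 vec_eq_iff forall_2)
  moreover from this have "C$2$2 = 1 \<or> C$2$2 = - 1"
    using dC by (simp add: det_2 square_eq_1_iff)
  ultimately have "C = mat 1 \<or> C = - mat 1"
    by (auto simp: matrix_simps_2)
  then show ?thesis using A by (auto simp: minus_one_mult)
qed

lemma tendsto_circle_pt:
  assumes "(f \<longlongrightarrow> v) F" "v \<noteq> 0"
  shows "((\<lambda>n. circle_pt (f n)) \<longlongrightarrow> circle_pt v) F"
  unfolding circle_pt_def
  by (intro tendsto_divide tendsto_Complex tendsto_minus tendsto_vec_nth assms) (simp add: assms)

lemma tendsto_SL2R_act:
  assumes "(A \<longlongrightarrow> A') F" "(p \<longlongrightarrow> p') F" "det A' \<noteq> 0" "p' \<in> sphere 0 1"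
  shows "((\<lambda>n. SL2R_act (A n) (p n)) \<longlongrightarrow> SL2R_act A' p') F"
proof -
  define U where "U A p = of_real (A $ 1 $ 1) * (\<i> * (1 + p)) + of_real (A $ 1 $ 2) * (1 - p)"
    for A :: "real^2^2" and p
  define V where "V A p = of_real (A $ 2 $ 1) * (\<i> * (1 + p)) + of_real (A $ 2 $ 2) * (1 - p)"
    for A :: "real^2^2" and p
  have act: "SL2R_act A p = (U A p - \<i> * V A p) / (U A p + \<i> * V A p)" for A p
    unfolding SL2R_act_def U_def V_def Let_def ..
  \<comment> \<open>As division by zero yields 0, a vanishing denominator would put the image at the
    centre of the disc instead of on the circle.\<close>
  have "U A' p' + \<i> * V A' p' \<noteq> 0"
  proof
    assume "U A' p' + \<i> * V A' p' = 0"
    then have "SL2R_act A' p' = 0" by (simp add: act)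
    then show False using SL2R_act_in_sphere[OF assms(3,4)] by simp
  qed
  then show ?thesis
    unfolding act
    by (intro tendsto_divide tendsto_diff tendsto_add tendsto_mult tendsto_const)
      (unfold U_def V_def, (intro tendsto_intros assms)+)
qed

text \<open>Twice the signed area of the triangle a b c. On the circle its sign is the cyclic order,
  but being polynomial it passes to limits.\<close>

definition orient :: "complex \<Rightarrow> complex \<Rightarrow> complex \<Rightarrow> real" where
  "orient a b c = Im (cnj (b - a) * (c - a))"

lemma orient_swap: "orient b a c = - orient a b c" "orient a c b = - orient a b c"
  by (simp_all add: orient_def algebra_simps)

lemma orient_rotate: "orient b c a = orient a b c" "orient c a b = orient a b c"
  by (simp_all add: orient_def algebra_simps)

lemma orient_refl [simp]: "orient a a c = 0" "orient a c a = 0" "orient c a a = 0"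
  by (simp_all add: orient_def algebra_simps)

lemma tendsto_orient:
  assumes "(f \<longlongrightarrow> a) F" "(g \<longlongrightarrow> b) F" "(h \<longlongrightarrow> c) F"
  shows "((\<lambda>n. orient (f n) (g n) (h n)) \<longlongrightarrow> orient a b c) F"
  unfolding orient_def by (intro tendsto_intros assms)

text \<open>Half-angle form of the area of an inscribed triangle. The sign can be read off from the
  three factors.\<close>

lemma orient_cis:
  assumes "a \<in> sphere 0 1"
  shows "orient a (a * cis s) (a * cis t) = 4 * sin (s / 2) * sin ((t - s) / 2) * sin (t / 2)"
proof -
  have "cnj a * a = 1" using assms complex_norm_square[of a] by (simp add: mult.commute)
  moreover have "cnj (a * cis s - a) * (a * cis t - a) = (cnj a * a) * (cnj (cis s - 1) * (cis t - 1))"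
    by (simp add: algebra_simps)
  ultimately have "orient a (a * cis s) (a * cis t) = Im (cnj (cis s - 1) * (cis t - 1))"
    by (simp add: orient_def)
  also have "\<dots> = sin (t - s) + sin s - sin t"
    by (simp add: sin_diff algebra_simps)
  also have "\<dots> = 4 * sin (s / 2) * sin ((t - s) / 2) * sin (t / 2)"
  proof -
    have "sin (2 * (y - x)) + sin (2 * x) - sin (2 * y) = 4 * sin x * sin (y - x) * sin y" for x y :: real
    proof -
      have x2: "cos x * cos x + sin x * sin x - 1 = 0" and y2: "1 - sin y * sin y - cos y * cos y = 0"
        using sin_cos_squared_add[of x] sin_cos_squared_add[of y] by (auto simp: power2_eq_square)
      have "sin (2 * (y - x)) + sin (2 * x) - sin (2 * y)
        = 2 * (sin y * cos x - cos y * sin x) * (cos y * cos x + sin y * sin x) + 2 * sin x * cos x - 2 * sin y * cos y"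
        by (simp only: sin_double sin_diff cos_diff)
      also have "\<dots> = 4 * sin x * (sin y * cos x - cos y * sin x) * sin y"
      proof -
        \<comment> \<open>With p, q, r, u standing for sin y, cos x, cos y, sin x, the difference of
          the two sides is a combination of the two Pythagorean relations.\<close>
        have "2 * (p * q - r * u) * (r * q + p * u) + 2 * u * q - 2 * p * r - 4 * u * (p * q - r * u) * p
          = 2 * p * r * (q * q + u * u - 1) + 2 * u * q * (1 - p * p - r * r)" for p q r u :: real
          by (simp add: algebra_simps)
        from this[of "sin y" "cos x" "cos y" "sin x"]
        show ?thesis unfolding x2 y2 by (simp only: mult_zero_right add_0_right right_minus_eq)
      qed
      finally show ?thesis by (simp add: sin_diff)
    qed
    from this[where x = "s / 2" and y = "t / 2"] show ?thesis
      by (simp add: right_diff_distrib diff_divide_distrib)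
  qed
  finally show ?thesis .
qed

lemma sphere_cisE:
  assumes "a \<in> sphere 0 1" "b \<in> sphere 0 1" "a \<noteq> b"
  obtains t where "0 < t" "t < 2 * pi" "b = a * cis t"
proof -
  have "b / a \<in> sphere 0 1" "b / a \<noteq> 1" using assms by (auto simp: norm_divide)
  then obtain t where t: "b / a = cis t" "0 \<le> t" "t < 2 * pi"
    by (metis Arg2pi Arg2pi_ge_0 Arg2pi_lt_2pi cis_conv_exp complex_norm_eq_1_exp mem_sphere_0 mult_1 of_real_1)
  then have "t \<noteq> 0" using \<open>b / a \<noteq> 1\<close> by auto
  moreover have "b = a * cis t"
    using t(1) assms(1) by (cases "a = 0") (auto simp: field_simps)
  ultimately show thesis using t by (intro that[of t]) auto
qed

text \<open>Write b and c with angles s and t from a. If s < t, the three sines are positive;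
  otherwise b and c are exchanged, which changes the sign.\<close>

lemma cyc_order_eq_sgn_orient:
  assumes "a \<in> sphere 0 1" "b \<in> sphere 0 1" "c \<in> sphere 0 1"
  shows "real_of_int (cyc_order a b c) = sgn (orient a b c)"
proof (cases "a = b \<or> b = c \<or> a = c")
  case True
  then show ?thesis by (auto simp: cyc_order_def)
next
  case False
  have pos: "orient a (a * cis s) (a * cis t) > 0" if "0 < s" "s < t" "t < 2 * pi" for s t
    unfolding orient_cis[OF assms(1)] using that by (intro mult_pos_pos sin_gt_zero) auto
  obtain s where s: "0 < s" "s < 2 * pi" "b = a * cis s"
    using sphere_cisE[OF assms(1,2)] False by blast
  obtain t where t: "0 < t" "t < 2 * pi" "c = a * cis t"
    using sphere_cisE[OF assms(1,3)] False by blast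
  show ?thesis
  proof (cases "s < t")
    case True
    then have "cyc_order a b c = 1" using False s t unfolding cyc_order_def by auto
    then show ?thesis using pos[OF s(1) True t(2)] s t by simp
  next
    case nst: False
    then have "orient a c b > 0" using pos[OF t(1) _ s(2)] s t False by (cases "s = t") auto
    then have neg: "orient a b c < 0" using orient_swap(2)[of a b c] by simp
    then have "\<not> (\<exists>s t. 0 < s \<and> s < t \<and> t < 2 * pi \<and> b = a * cis s \<and> c = a * cis t)"
      using pos by fastforce
    then have "cyc_order a b c = - 1" using False unfolding cyc_order_def by simp
    then show ?thesis using neg by simp
  qed
qed

text \<open>A line determines its spanning vector only up to a factor, but each vector occurs twice
  in the product of wedges, so the sign of the product depends on the lines alone.\<close>

lemma orient_circle_pt:
  assumes "u \<noteq> 0" "v \<noteq> 0" "w \<noteq> 0"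
  obtains k where "k > 0" "orient (circle_pt u) (circle_pt v) (circle_pt w) = k * (wedge u v * wedge v w * wedge w u)"
proof
  define z where "z x = Complex (x$1) (x$2)" for x :: "real^2"
  have z: "z u \<noteq> 0" "z v \<noteq> 0" "z w \<noteq> 0" using assms by (auto simp: z_def)
  have d: "circle_pt v - circle_pt u = 2 * \<i> * of_real (wedge v u) / (z u * z v)"
      "circle_pt w - circle_pt u = 2 * \<i> * of_real (wedge w u) / (z u * z w)"
    using circle_pt_diff assms unfolding z_def by blast+
  let ?N = "\<lambda>x. (cmod (z x))\<^sup>2"
  have "cnj (circle_pt v - circle_pt u) * (circle_pt w - circle_pt u)
      = 4 * of_real (wedge v u * wedge w u) / (cnj (z u) * z u * cnj (z v) * z w)"
  proof -
    have i: "\<i> * (a * (\<i> * b)) = - (a * b)" for a b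
      by (simp add: complex_eq_iff algebra_simps)
    show ?thesis unfolding d by (simp add: i mult.assoc mult.left_commute)
  qed
  also have "\<dots> = 4 * of_real (wedge v u * wedge w u) * (z v * cnj (z w)) / of_real (?N u * ?N v * ?N w)"
    unfolding of_real_mult complex_norm_square
    using z by (subst frac_eq_eq) (simp_all add: mult.assoc mult.left_commute)
  finally have "orient (circle_pt u) (circle_pt v) (circle_pt w)
      = Im (of_real (4 * (wedge v u * wedge w u) / (?N u * ?N v * ?N w)) * (z v * cnj (z w)))"
    by (simp add: orient_def)
  also have "\<dots> = 4 * (wedge v u * wedge w u) / (?N u * ?N v * ?N w) * Im (z v * cnj (z w))"
    by (simp only: Re_complex_of_real Im_complex_of_real times_complex.sel mult_zero_left add_0_right)
  also have "Im (z v * cnj (z w)) = - wedge v w"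
    by (simp add: z_def wedge_def)
  also have "wedge v u = - wedge u v" by (simp add: wedge_def)
  finally show "orient (circle_pt u) (circle_pt v) (circle_pt w)
     = 4 / (?N u * ?N v * ?N w) * (wedge u v * wedge v w * wedge w u)"
    by (simp add: mult_ac)
  show "4 / (?N u * ?N v * ?N w) > 0" using z by simp
qed

section \<open>Cyclic order preserving relations\<close>

text \<open>Two of the sines are positive, and (t - s)/2 lies between -\<pi> and \<pi>, where the
  sine has the sign of its argument.\<close>

lemma orient_cis_pos_iff:
  assumes "a \<in> sphere 0 1" "0 < s" "s < 2 * pi" "0 < t" "t < 2 * pi"
  shows "orient a (a * cis s) (a * cis t) > 0 \<longleftrightarrow> s < t"
proof -
  have "sin (s / 2) > 0" "sin (t / 2) > 0" using assms by (auto intro: sin_gt_zero)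
  then have "orient a (a * cis s) (a * cis t) > 0 \<longleftrightarrow> sin ((t - s) / 2) > 0"
    unfolding orient_cis[OF assms(1)] by (simp add: zero_less_mult_iff)
  also have "\<dots> \<longleftrightarrow> s < t"
  proof
    assume "sin ((t - s) / 2) > 0"
    moreover have "sin ((s - t) / 2) \<ge> 0" if "s \<ge> t"
      using that assms by (intro sin_ge_zero) auto
    moreover have "sin ((t - s) / 2) = - sin ((s - t) / 2)"
      by (metis minus_diff_eq minus_divide_left sin_minus)
    ultimately show "s < t" by force
  next
    assume "s < t"
    then show "sin ((t - s) / 2) > 0" using assms by (intro sin_gt_zero) auto
  qed
  finally show ?thesis .
qed

lemma orient_eq_0_iff:
  assumes "a \<in> sphere 0 1" "b \<in> sphere 0 1" "c \<in> sphere 0 1"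
  shows "orient a b c = 0 \<longleftrightarrow> a = b \<or> b = c \<or> a = c"
proof -
  have "orient a b c = 0 \<longleftrightarrow> cyc_order a b c = 0"
    using cyc_order_eq_sgn_orient[OF assms] by (metis of_int_eq_0_iff sgn_eq_0_iff)
  also have "\<dots> \<longleftrightarrow> a = b \<or> b = c \<or> a = c" by (auto simp: cyc_order_def)
  finally show ?thesis .
qed

text \<open>In terms of the angles measured from a, x comes before b and b before y.\<close>

lemma orient_pos_trans:
  assumes S: "a \<in> sphere 0 1" "x \<in> sphere 0 1" "b \<in> sphere 0 1" "y \<in> sphere 0 1"
    and "orient a x b > 0" "orient b y a > 0"
  shows "orient a x y > 0"
proof -
  have aby: "orient a b y > 0" using assms(6) orient_rotate by metis
  have "x \<noteq> a" "b \<noteq> a" "y \<noteq> a" using assms(5,6) by auto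
  then obtain s t u where st: "0 < s" "s < 2 * pi" "x = a * cis s" "0 < t" "t < 2 * pi" "b = a * cis t"
      "0 < u" "u < 2 * pi" "y = a * cis u"
    using sphere_cisE[OF S(1)] S by metis
  then have "s < t" "t < u" using assms(5) aby orient_cis_pos_iff[OF S(1)] by auto
  then show ?thesis using st orient_cis_pos_iff[OF S(1), of s u] by simp
qed

text \<open>Signs are required to agree, including the value 0, and both projections to be dense, so
  the conditions pass to the converse of W. Each statement about one coordinate then holds for the
  other too.\<close>

locale cyclic_dense =
  fixes W :: "(complex \<times> complex) set"
  assumes in_sphere: "(a, a') \<in> W \<Longrightarrow> a \<in> sphere 0 1 \<and> a' \<in> sphere 0 1"
    and order: "(a, a') \<in> W \<Longrightarrow> (b, b') \<in> W \<Longrightarrow> (c, c') \<in> W \<Longrightarrow>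
      sgn (orient a b c) = sgn (orient a' b' c')"
    and dense_fst: "sphere 0 1 \<subseteq> closure (fst ` W)"
    and dense_snd: "sphere 0 1 \<subseteq> closure (snd ` W)"
begin

lemma closureE:
  assumes "(P, Q) \<in> closure W"
  obtains f g where "\<And>n. (f n, g n) \<in> W" "f \<longlonglongrightarrow> P" "g \<longlonglongrightarrow> Q"
proof -
  obtain h where h: "\<And>n. h n \<in> W" "h \<longlonglongrightarrow> (P, Q)"
    using assms unfolding closure_sequential by blast
  then show thesis
    using that[of "fst \<circ> h" "snd \<circ> h"] tendsto_fst[OF h(2)] tendsto_snd[OF h(2)] by (simp add: comp_def)
qed

lemma closureI:
  assumes "\<And>n. (f n, g n) \<in> closure W" "f \<longlonglongrightarrow> P" "g \<longlonglongrightarrow> Q"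
  shows "(P, Q) \<in> closure W"
  using assms closed_sequentially[of "closure W" "\<lambda>n. (f n, g n)" "(P, Q)"]
  by (simp add: tendsto_Pair)

lemma closure_in_sphere:
  assumes "(P, Q) \<in> closure W"
  shows "P \<in> sphere 0 1" "Q \<in> sphere 0 1"
proof -
  obtain f g where fg: "\<And>n. (f n, g n) \<in> W" "f \<longlonglongrightarrow> P" "g \<longlonglongrightarrow> Q"
    by (rule closureE[OF assms]) (rule that)
  show "P \<in> sphere 0 1" "Q \<in> sphere 0 1"
    using closed_sequentially[OF closed_sphere _ fg(2)] closed_sequentially[OF closed_sphere _ fg(3)]
      in_sphere[OF fg(1)] by blast+
qed

lemma converse: "cyclic_dense (W\<inverse>)"
proof
  show "sphere 0 1 \<subseteq> closure (fst ` W\<inverse>)" "sphere 0 1 \<subseteq> closure (snd ` W\<inverse>)"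
    using dense_fst dense_snd by (simp_all add: Domain_fst[symmetric] Range_snd[symmetric])
next
  fix a a' assume "(a, a') \<in> W\<inverse>"
  then show "a \<in> sphere 0 1 \<and> a' \<in> sphere 0 1" using in_sphere by blast
next
  fix a a' b b' c c'
  assume "(a, a') \<in> W\<inverse>" "(b, b') \<in> W\<inverse>" "(c, c') \<in> W\<inverse>"
  then show "sgn (orient a b c) = sgn (orient a' b' c')" using order[of a' a b' b c' c] by simp
qed

lemma closure_converse:
  assumes "(P, Q) \<in> closure W"
  shows "(Q, P) \<in> closure (W\<inverse>)"
proof -
  obtain f g where fg: "\<And>n. (f n, g n) \<in> W" "f \<longlonglongrightarrow> P" "g \<longlonglongrightarrow> Q"
    by (rule closureE[OF assms]) (rule that)
  then show ?thesis
    unfolding closure_sequential by (intro exI[of _ "\<lambda>n. (g n, f n)"]) (simp add: tendsto_Pair)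
qed

text \<open>Points of the first projection approximate P, and compactness of the second circle makes
  a subsequence of their partners converge.\<close>

lemma closure_total:
  assumes "P \<in> sphere 0 1"
  shows "\<exists>Q. (P, Q) \<in> closure W"
proof -
  have "P \<in> closure (fst ` W)" using dense_fst assms by blast
  then obtain f where f: "\<And>n. f n \<in> fst ` W" "f \<longlonglongrightarrow> P"
    unfolding closure_sequential by blast
  have "\<exists>q. (f n, q) \<in> W" for n using f(1)[of n] by auto
  then obtain g where g: "\<And>n. (f n, g n) \<in> W" by metis
  then have "\<forall>n. g n \<in> sphere 0 1" using in_sphere by blast
  then obtain Q r where r: "strict_mono r" "(g \<circ> r) \<longlonglongrightarrow> Q"
    using compact_sphere[of "0::complex" 1] unfolding compact_def by blast
  have "(P, Q) \<in> closure W"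
    using closureI[of "f \<circ> r" "g \<circ> r"] g LIMSEQ_subseq_LIMSEQ[OF f(2) r(1)] r(2) closure_subset
    by (metis comp_apply subset_iff)
  then show ?thesis ..
qed

text \<open>A strict inequality between limits already holds along the sequences, passes to the
  other coordinate by \<open>order\<close>, and returns to the limit as a weak one.\<close>

lemma weak_order:
  assumes "(P, P') \<in> closure W" "(Q, Q') \<in> closure W" "(R, R') \<in> closure W" "orient P' Q' R' > 0"
  shows "orient P Q R \<ge> 0"
proof -
  obtain p p' where p: "\<And>n. (p n, p' n) \<in> W" "p \<longlonglongrightarrow> P" "p' \<longlonglongrightarrow> P'"
    by (rule closureE[OF assms(1)]) (rule that)
  obtain q q' where q: "\<And>n. (q n, q' n) \<in> W" "q \<longlonglongrightarrow> Q" "q' \<longlonglongrightarrow> Q'"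
    by (rule closureE[OF assms(2)]) (rule that)
  obtain r r' where r: "\<And>n. (r n, r' n) \<in> W" "r \<longlonglongrightarrow> R" "r' \<longlonglongrightarrow> R'"
    by (rule closureE[OF assms(3)]) (rule that)
  have "\<forall>\<^sub>F n in sequentially. orient (p' n) (q' n) (r' n) > 0"
    by (rule order_tendstoD(1)[OF tendsto_orient[OF p(3) q(3) r(3)] assms(4)])
  then have "\<forall>\<^sub>F n in sequentially. orient (p n) (q n) (r n) \<ge> 0"
  proof eventually_elim
    case (elim n)
    then show ?case using order[OF p(1) q(1) r(1), of n n n] by (simp add: sgn_if split: if_splits)
  qed
  then show ?thesis
    using tendsto_lowerbound[OF tendsto_orient[OF p(2) q(2) r(2)]] by simp
qed

text \<open>Besides producing a point of the arc, the freedom in s and e makes it possible to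
  produce two distinct ones.\<close>

lemma arc_meets:
  assumes "Q \<in> sphere 0 1" "0 < s" "s < t" "t < 2 * pi" "e > 0"
  shows "\<exists>x' x. (x', x) \<in> W \<and> dist x (Q * cis s) < e \<and> orient Q x (Q * cis t) > 0"
proof -
  have "Q * cis s \<in> closure (snd ` W)"
    using dense_snd assms(1) by (auto simp: norm_mult)
  then obtain f where f: "\<And>n. f n \<in> snd ` W" "f \<longlonglongrightarrow> Q * cis s"
    unfolding closure_sequential by blast
  have "orient Q (Q * cis s) (Q * cis t) > 0"
    using assms by (subst orient_cis_pos_iff) auto
  from order_tendstoD(1)[OF tendsto_orient[OF tendsto_const f(2) tendsto_const] this]
  have "\<forall>\<^sub>F n in sequentially. orient Q (f n) (Q * cis t) > 0" .
  moreover have "\<forall>\<^sub>F n in sequentially. dist (f n) (Q * cis s) < e"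
    using f(2) assms(5) by (simp add: tendsto_iff)
  ultimately have "\<forall>\<^sub>F n in sequentially. dist (f n) (Q * cis s) < e \<and> orient Q (f n) (Q * cis t) > 0"
    by eventually_elim simp
  then obtain n where "dist (f n) (Q * cis s) < e" "orient Q (f n) (Q * cis t) > 0"
    using eventually_happens'[OF sequentially_bot] by blast
  then show ?thesis using f(1)[of n] by force
qed

text \<open>A related pair whose second point lies strictly between b and b' would make a positive
  triple correspond to one of the form a, x', a.\<close>

lemma W_functional:
  assumes "(a, b) \<in> W" "(a, b') \<in> W"
  shows "b = b'"
proof (rule ccontr)
  assume "b \<noteq> b'"
  then obtain t where t: "0 < t" "t < 2 * pi" "b' = b * cis t"
    using sphere_cisE in_sphere assms by metis
  obtain x' x where x: "(x', x) \<in> W" "orient b x b' > 0"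
    using arc_meets[of b "t / 2" t 1] in_sphere[OF assms(1)] t by auto
  show False using order[OF assms(1) x(1) assms(2)] x(2) by simp
qed

text \<open>Points of the arc close to the angles t/2 and t/3 are distinct, hence so are their
  partners, and at most one of these is p.\<close>

lemma arc_avoiding:
  assumes "Q \<in> sphere 0 1" "Q' \<in> sphere 0 1" "Q \<noteq> Q'"
  shows "\<exists>x' x. (x', x) \<in> W \<and> orient Q x Q' > 0 \<and> x' \<noteq> p"
proof -
  obtain t where t: "0 < t" "t < 2 * pi" "Q' = Q * cis t"
    using sphere_cisE assms by metis
  have "Q * cis (t / 2) \<noteq> Q * cis (t / 3)"
  proof
    assume eq: "Q * cis (t / 2) = Q * cis (t / 3)"
    have "orient Q (Q * cis (t / 3)) (Q * cis (t / 2)) > 0"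
      using assms(1) t by (subst orient_cis_pos_iff) auto
    then show False unfolding eq by simp
  qed
  then have d: "dist (Q * cis (t / 2)) (Q * cis (t / 3)) / 2 > 0" by simp
  obtain x' x where x: "(x', x) \<in> W" "orient Q x Q' > 0"
      "dist x (Q * cis (t / 2)) < dist (Q * cis (t / 2)) (Q * cis (t / 3)) / 2"
    using arc_meets[of Q "t / 2" t, OF _ _ _ _ d] assms t by auto
  obtain y' y where y: "(y', y) \<in> W" "orient Q y Q' > 0"
      "dist y (Q * cis (t / 3)) < dist (Q * cis (t / 2)) (Q * cis (t / 3)) / 2"
    using arc_meets[of Q "t / 3" t, OF _ _ _ _ d] assms t by auto
  have "x \<noteq> y"
    using x(3) y(3) dist_triangle_half_r[of x "Q * cis (t / 2)"] dist_commute
    by (metis dist_triangle_half_r less_irrefl)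
  then have "x' \<noteq> y'" using x y W_functional by blast
  then show ?thesis using x y by metis
qed

text \<open>If \<open>P\<close> were related to \<open>Q\<close> and \<open>Q'\<close>, then for related pairs \<open>(x', x)\<close> and \<open>(y', y)\<close> with
  \<open>Q, x, Q', y\<close> in this order, the weak cyclic order would force \<open>P, x', y'\<close> to be both positively
  and negatively oriented.\<close>

lemma closure_functional:
  assumes "(P, Q) \<in> closure W" "(P, Q') \<in> closure W"
  shows "Q = Q'"
proof (rule ccontr)
  assume "Q \<noteq> Q'"
  have S: "P \<in> sphere 0 1" "Q \<in> sphere 0 1" "Q' \<in> sphere 0 1"
    using assms closure_in_sphere by blast+
  obtain x' x where x: "(x', x) \<in> W" "orient Q x Q' > 0" "x' \<noteq> P"
    using arc_avoiding[OF S(2,3) \<open>Q \<noteq> Q'\<close>] by blast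
  obtain y' y where y: "(y', y) \<in> W" "orient Q' y Q > 0" "y' \<noteq> P"
    using arc_avoiding[OF S(3,2)] \<open>Q \<noteq> Q'\<close> by blast
  have "orient Q' z Q = - orient Q z Q'" for z
    by (simp add: orient_def algebra_simps)
  then have "x \<noteq> y"
    using x(2) y(2) by force
  then have xy: "x' \<noteq> y'" using x y W_functional by blast
  note Sx = in_sphere[OF x(1)] in_sphere[OF y(1)]
  have "orient Q x y > 0" "orient Q' y x > 0"
    using orient_pos_trans[of Q x Q' y] orient_pos_trans[of Q' y Q x] S Sx x y by auto
  then have "orient P x' y' \<ge> 0" "orient P y' x' \<ge> 0"
    using weak_order[OF assms(1)] weak_order[OF assms(2)] x(1) y(1) closure_subset by blast+
  then have "orient P x' y' = 0" using orient_swap(2)[of P x' y'] by simp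
  then show False using orient_eq_0_iff S Sx x y xy by metis
qed

lemma closure_injective:
  assumes "(P, Q) \<in> closure W" "(P', Q) \<in> closure W"
  shows "P = P'"
  using cyclic_dense.closure_functional[OF converse closure_converse[OF assms(1)] closure_converse[OF assms(2)]] .

lemma closure_surjective:
  assumes "Q \<in> sphere 0 1"
  shows "\<exists>P. (P, Q) \<in> closure W"
  using cyclic_dense.closure_total[OF converse assms] cyclic_dense.closure_converse[OF converse] by fastforce

text \<open>The weak order of the converse leaves only the degenerate case, where two image points
  coincide; injectivity excludes it.\<close>

lemma closure_order:
  assumes "(P, P') \<in> closure W" "(Q, Q') \<in> closure W" "(R, R') \<in> closure W" "orient P Q R > 0"
  shows "orient P' Q' R' > 0"
proof -
  have "orient P' Q' R' \<ge> 0"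
    using cyclic_dense.weak_order[OF converse] closure_converse assms by blast
  moreover have "orient P' Q' R' \<noteq> 0"
  proof
    assume "orient P' Q' R' = 0"
    then have "P' = Q' \<or> Q' = R' \<or> P' = R'"
      using orient_eq_0_iff closure_in_sphere(2) assms by blast
    then have "P = Q \<or> Q = R \<or> P = R" using closure_injective assms by blast
    then show False using assms(4) by auto
  qed
  ultimately show ?thesis by simp
qed

end

section \<open>Relations normalising \<open>SL(2,\<real>)\<close>\<close>

text \<open>f fixes the integers, so by monotonicity it never falls more than 1 below the identity,
  whereas a gap x - f x > 0 would grow without bound along multiples of x. Applying this to -x gives
  the other inequality.\<close>

lemma additive_strict_mono_imp_id:
  fixes f :: "real \<Rightarrow> real"
  assumes add: "\<And>x y. f (x + y) = f x + f y" and mono: "\<And>x y. x < y \<Longrightarrow> f x < f y"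
    and one: "f 1 = 1"
  shows "f x = x"
proof -
  have zero: "f 0 = 0" using add[of 0 0] by simp
  have minus: "f (- x) = - f x" for x using add[of x "- x"] zero by simp
  have mult: "f (real n * x) = real n * f x" for n x
    by (induction n) (simp_all add: zero add distrib_right)
  have int: "f (of_int m) = of_int m" for m
  proof (cases m)
    case (nonneg n)
    then show ?thesis using mult[of n 1] one by simp
  next
    case (neg n)
    then show ?thesis using mult[of "Suc n" 1] one minus[of "real (Suc n)"] by simp
  qed
  have le: "x \<le> f x" for x
  proof (rule ccontr)
    assume "\<not> x \<le> f x"
    then obtain n where n: "real n * (x - f x) > 1"
      using reals_Archimedean3[of "x - f x"] by auto
    have "of_int \<lfloor>real n * x\<rfloor> \<le> f (real n * x)"
      using mono[of "of_int \<lfloor>real n * x\<rfloor>" "real n * x"] int[of "\<lfloor>real n * x\<rfloor>"]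
        of_int_floor_le[of "real n * x"] by (cases "of_int \<lfloor>real n * x\<rfloor> = real n * x") auto
    then show False using n mult[of n x] by (simp add: right_diff_distrib) linarith
  qed
  show ?thesis using le[of x] le[of "- x"] minus[of x] by simp
qed

lemma det_scaleR_2: "det (c *\<^sub>R A) = c\<^sup>2 * det (A :: real^2^2)"
  by (simp add: det_2 power2_eq_square algebra_simps)

text \<open>Homogeneous coordinates on the boundary of the upper half-plane: \<open>pt x 1\<close>
  is the real number x and \<open>pt 1 0\<close> is infinity.\<close>

abbreviation pt :: "real \<Rightarrow> real \<Rightarrow> complex" where
  "pt x y \<equiv> circle_pt (vector [x, y])"

lemma vector_nonzero: "x \<noteq> 0 \<or> y \<noteq> 0 \<Longrightarrow> vector [x, y] \<noteq> (0 :: real^2)"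
  by (auto simp: vec_eq_iff forall_2)

lemma pt_in_sphere: "x \<noteq> 0 \<or> y \<noteq> 0 \<Longrightarrow> pt x y \<in> sphere 0 1"
  by (intro circle_pt_in_sphere vector_nonzero)

lemma SL2R_act_pt:
  assumes "x \<noteq> 0 \<or> y \<noteq> 0"
  shows "SL2R_act (mat2 a b c d) (pt x y) = pt (a * x + b * y) (c * x + d * y)"
proof -
  have "mat2 a b c d *v vector [x, y] = vector [a * x + b * y, c * x + d * y]"
    by (simp add: vec_eq_iff forall_2 matrix_vector_nth_2)
  then show ?thesis using SL2R_act_circle_pt[OF vector_nonzero[OF assms]] by simp
qed

lemma pt_eq_iff:
  assumes "x \<noteq> 0 \<or> y \<noteq> 0" "x' \<noteq> 0 \<or> y' \<noteq> 0"
  shows "pt x y = pt x' y' \<longleftrightarrow> x * y' = y * x'"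
  using circle_pt_eq_iff[OF vector_nonzero[OF assms(1)] vector_nonzero[OF assms(2)]]
  by (simp add: wedge_def)

lemma sphere_pt_cases:
  assumes "P \<in> sphere 0 1"
  shows "P = pt 1 0 \<or> (\<exists>x. P = pt x 1)"
proof -
  obtain v where v: "v \<noteq> 0" "P = circle_pt v" using sphere_circle_ptE[OF assms] .
  show ?thesis
  proof (cases "v$2 = 0")
    case True
    then have "P = pt 1 0" using v by (simp add: circle_pt_eq_iff vector_nonzero wedge_def)
    then show ?thesis ..
  next
    case False
    then have "P = pt (v$1 / v$2) 1" using v by (simp add: circle_pt_eq_iff vector_nonzero wedge_def)
    then show ?thesis by blast
  qed
qed

lemma orient_pt_pos_iff: "orient (pt 1 0) (pt x 1) (pt y 1) > 0 \<longleftrightarrow> x < y"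
proof -
  obtain k where "k > 0" "orient (pt 1 0) (pt x 1) (pt y 1) = k * (wedge (vector [1, 0]) (vector [x, 1])
      * wedge (vector [x, 1]) (vector [y, 1]) * wedge (vector [y, 1]) (vector [1, 0]))"
    using orient_circle_pt[of "vector [1, 0]" "vector [x, 1]" "vector [y, 1]"]
    by (auto simp: vector_nonzero)
  then show ?thesis by (simp add: wedge_def zero_less_mult_iff)
qed

text \<open>A bijection of the circle that normalises \<open>SL(2,\<real>)\<close> and fixes \<open>\<infinity>\<close> conjugates translations to
  maps with no fixed point but \<open>\<infinity>\<close>, that is, to translations; hence it is additive on \<open>\<real>\<close>.\<close>

lemma normalising_relation_id:
  fixes K :: "complex \<Rightarrow> complex \<Rightarrow> bool"
  assumes dom: "\<And>P Q. K P Q \<Longrightarrow> P \<in> sphere 0 1 \<and> Q \<in> sphere 0 1"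
    and total: "\<And>P. P \<in> sphere 0 1 \<Longrightarrow> \<exists>Q. K P Q"
    and surj: "\<And>Q. Q \<in> sphere 0 1 \<Longrightarrow> \<exists>P. K P Q"
    and func: "\<And>P Q Q'. K P Q \<Longrightarrow> K P Q' \<Longrightarrow> Q = Q'"
    and inj: "\<And>P P' Q. K P Q \<Longrightarrow> K P' Q \<Longrightarrow> P = P'"
    and ord: "\<And>P P' Q Q' R R'. K P P' \<Longrightarrow> K Q Q' \<Longrightarrow> K R R' \<Longrightarrow> orient P Q R > 0 \<Longrightarrow> orient P' Q' R' > 0"
    and normal: "\<And>A. det A = 1 \<Longrightarrow> \<exists>B. det B = 1 \<and> (\<forall>P Q. K P Q \<longrightarrow> K (SL2R_act A P) (SL2R_act B Q))"
    and fixes_pts: "K (pt 1 0) (pt 1 0)" "K (pt 0 1) (pt 0 1)" "K (pt 1 1) (pt 1 1)"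
    and P: "P \<in> sphere 0 1"
  shows "K P P"
proof -
  have inf: "pt x 1 \<noteq> pt 1 0" and sph: "pt x 1 \<in> sphere 0 1" for x
    using pt_in_sphere[of x 1] by (simp_all add: pt_eq_iff)
  have "\<exists>y. K (pt x 1) (pt y 1)" for x
  proof -
    obtain Q where Q: "K (pt x 1) Q" using total[OF sph] by blast
    then have "Q \<noteq> pt 1 0" using inj fixes_pts(1) inf by metis
    then show ?thesis using Q dom sphere_pt_cases by blast
  qed
  then obtain f where f: "\<And>x. K (pt x 1) (pt (f x) 1)" by metis
  have fI: "y = f x" if "K (pt x 1) (pt y 1)" for x y
    using func[OF that f] by (simp add: pt_eq_iff)
  have f_inj: "x = y" if "f x = f y" for x y
    using inj[of "pt x 1" "pt (f x) 1" "pt y 1"] f that by (simp add: pt_eq_iff) metis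
  have f_surj: "\<exists>x. f x = y" for y
  proof -
    obtain P where P: "K P (pt y 1)" using surj[OF sph] by blast
    then have "P \<noteq> pt 1 0" using func fixes_pts(1) inf by metis
    then show ?thesis using P dom sphere_pt_cases fI by metis
  qed
  have zero: "f 0 = 0" and one: "f 1 = 1" using fI fixes_pts(2,3) by auto
  have transl: "\<exists>b. \<forall>x. f (x + t) = f x + b" for t
  proof (cases "t = 0")
    case False
    obtain B where B: "det B = 1" "\<And>P Q. K P Q \<Longrightarrow> K (SL2R_act (mat2 1 t 0 1) P) (SL2R_act B Q)"
      using normal[of "mat2 1 t 0 1"] by auto
    have B2: "B = mat2 (B$1$1) (B$1$2) (B$2$1) (B$2$2)" by (simp add: matrix_eq_2)
    have act: "SL2R_act B (pt x y) = pt (B$1$1 * x + B$1$2 * y) (B$2$1 * x + B$2$2 * y)"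
      if "x \<noteq> 0 \<or> y \<noteq> 0" for x y
      using SL2R_act_pt[OF that] B2 by metis
    have "K (pt 1 0) (pt (B$1$1) (B$2$1))"
      using B(2)[OF fixes_pts(1)] by (simp add: SL2R_act_pt act)
    \<comment> \<open>The translation fixes infinity and K relates infinity to itself, so B fixes
      infinity too and is upper triangular.\<close>
    then have "pt (B$1$1) (B$2$1) = pt 1 0" using func fixes_pts(1) by blast
    moreover have "B$1$1 \<noteq> 0 \<or> B$2$1 \<noteq> 0" using B(1) by (auto simp: det_2)
    ultimately have B21: "B$2$1 = 0" by (simp add: pt_eq_iff)
    then have d: "B$1$1 * B$2$2 = 1" using B(1) by (simp add: det_2)
    then have nz: "B$1$1 \<noteq> 0" "B$2$2 \<noteq> 0" by auto
    define \<alpha> \<beta> where "\<alpha> = B$1$1 / B$2$2" and "\<beta> = B$1$2 / B$2$2"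
    have aff: "f (x + t) = \<alpha> * f x + \<beta>" for x
    proof -
      have "K (pt (x + t) 1) (pt (B$1$1 * f x + B$1$2) (B$2$2))"
        using B(2)[OF f[of x]] by (simp add: SL2R_act_pt act B21)
      also have "pt (B$1$1 * f x + B$1$2) (B$2$2) = pt (\<alpha> * f x + \<beta>) 1"
        using nz by (simp add: pt_eq_iff \<alpha>_def \<beta>_def add_divide_distrib[symmetric])
      finally show ?thesis using fI by simp
    qed
    have "\<alpha> = 1"
    proof (rule ccontr)
      assume "\<alpha> \<noteq> 1"
      \<comment> \<open>The fixed point of the affine map y \<mapsto> \<alpha> y + \<beta>. As it is
        a value of f, the translation by t would also fix a real point.\<close>
      obtain x where x: "f x = \<beta> / (1 - \<alpha>)" using f_surj by blast
      have "f (x + t) = f x"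
        using aff[of x] \<open>\<alpha> \<noteq> 1\<close> unfolding x by (simp add: field_simps)
      then show False using f_inj False by fastforce
    qed
    then show ?thesis using aff by (intro exI[of _ \<beta>]) simp
  qed (auto intro: exI[of _ 0])
  have "f (x + t) = f x + f t" for x t
    using transl[of t] zero by (metis add_0)
  moreover have "f x < f y" if "x < y" for x y
    using ord[OF fixes_pts(1) f f, of x y] that by (simp add: orient_pt_pos_iff)
  ultimately have "f x = x" for x
    using additive_strict_mono_imp_id[of f] one by blast
  then show ?thesis using sphere_pt_cases[OF P] f fixes_pts(1) by metis
qed

text \<open>Cramer's rule gives r = l p + m q, and the matrix with columns l p and m q carries
  (1,0), (0,1), (1,1) to the three lines. Its determinant has the sign of the orientation, so it can
  be rescaled to 1.\<close>

lemma SL2R_act_three_points: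
  assumes "P \<in> sphere 0 1" "Q \<in> sphere 0 1" "R \<in> sphere 0 1" "orient P Q R > 0"
  shows "\<exists>T. det T = 1 \<and> SL2R_act T (pt 1 0) = P \<and> SL2R_act T (pt 0 1) = Q \<and> SL2R_act T (pt 1 1) = R"
proof -
  obtain p q r where p: "p \<noteq> 0" "P = circle_pt p" and q: "q \<noteq> 0" "Q = circle_pt q"
      and r: "r \<noteq> 0" "R = circle_pt r"
    using assms sphere_circle_ptE by metis
  define w where "w = wedge p q"
  have pos: "wedge p q * wedge q r * wedge r p > 0"
    using orient_circle_pt[OF p(1) q(1) r(1)] assms(4) p q r by (metis zero_less_mult_pos)
  then have w: "w \<noteq> 0" unfolding w_def by auto
  define l m where "l = wedge r q / w" and "m = wedge p r / w"
  have "wedge q r \<noteq> 0" "wedge r p \<noteq> 0" using pos by auto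
  moreover have "wedge r q = - wedge q r" "wedge p r = - wedge r p" by (simp_all add: wedge_def)
  ultimately have lm: "l \<noteq> 0" "m \<noteq> 0" using w unfolding l_def m_def by auto
  define T where "T = mat2 (l * p$1) (m * q$1) (l * p$2) (m * q$2)"
  have "det T = l * m * w" by (simp add: T_def w_def wedge_def algebra_simps)
  also have "\<dots> = (wedge p q * wedge q r * wedge r p) / w\<^sup>2"
    using w by (simp add: l_def m_def w_def[symmetric] field_simps power2_eq_square)
      (simp add: wedge_def algebra_simps)
  also have "\<dots> > 0" using pos w by simp
  finally have dT: "det T > 0" .
  have cols: "T *v vector [1, 0] = l *\<^sub>R p" "T *v vector [0, 1] = m *\<^sub>R q"
    by (simp_all add: T_def vec_eq_iff forall_2 matrix_vector_nth_2)
  have "w *\<^sub>R (T *v vector [1, 1]) = w *\<^sub>R r"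
    using w by (simp add: T_def vec_eq_iff forall_2 matrix_vector_nth_2 l_def m_def field_simps)
      (simp add: w_def wedge_def algebra_simps)
  then have c3: "T *v vector [1, 1] = r" using w by simp
  define S where "S = (1 / sqrt (det T)) *\<^sub>R T"
  have "det S = (1 / sqrt (det T))\<^sup>2 * det T"
    by (simp only: S_def det_scaleR_2)
  then have "det S = 1" using dT by (simp add: power_divide)
  moreover have "SL2R_act S (pt x y) = circle_pt (T *v vector [x, y])" if "x \<noteq> 0 \<or> y \<noteq> 0" for x y
  proof -
    have "SL2R_act S (pt x y) = SL2R_act T (pt x y)"
      unfolding S_def using dT by (intro SL2R_act_scaleR pt_in_sphere[OF that]) simp
    also have "\<dots> = circle_pt (T *v vector [x, y])"
      by (rule SL2R_act_circle_pt[OF vector_nonzero[OF that]])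
    finally show ?thesis .
  qed
  ultimately show ?thesis
    using p q r lm by (intro exI[of _ S]) (simp add: cols c3 circle_pt_scaleR)
qed

lemma matrix_eq_0_if_kernel:
  fixes N :: "real^2^2"
  assumes "N *v x = 0" "N *v y = 0" "wedge x y \<noteq> 0"
  shows "N = 0"
proof -
  have e: "N$i$1 * x$1 + N$i$2 * x$2 = 0" "N$i$1 * y$1 + N$i$2 * y$2 = 0" for i
    using assms(1,2) matrix_vector_nth_2[of N x i] matrix_vector_nth_2[of N y i] by auto
  have "wedge x y * N$i$1 = 0" "wedge x y * N$i$2 = 0" for i
  proof -
    have "wedge x y * N$i$1 = y$2 * (N$i$1 * x$1 + N$i$2 * x$2) - x$2 * (N$i$1 * y$1 + N$i$2 * y$2)"
      "wedge x y * N$i$2 = x$1 * (N$i$1 * y$1 + N$i$2 * y$2) - y$1 * (N$i$1 * x$1 + N$i$2 * x$2)"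
      by (simp_all add: wedge_def algebra_simps)
    then show "wedge x y * N$i$1 = 0" "wedge x y * N$i$2 = 0" using e[of i] by simp_all
  qed
  then show ?thesis using assms(3) by (simp add: matrix_eq_2)
qed

lemma orient_SL2R_act_pos_iff:
  assumes "det T = 1" and S: "P \<in> sphere 0 1" "Q \<in> sphere 0 1" "R \<in> sphere 0 1"
  shows "orient (SL2R_act T P) (SL2R_act T Q) (SL2R_act T R) > 0 \<longleftrightarrow> orient P Q R > 0"
proof -
  obtain p where p: "p \<noteq> 0" "P = circle_pt p" using sphere_circle_ptE[OF S(1)] .
  obtain q where q: "q \<noteq> 0" "Q = circle_pt q" using sphere_circle_ptE[OF S(2)] .
  obtain r where r: "r \<noteq> 0" "R = circle_pt r" using sphere_circle_ptE[OF S(3)] .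
  have nz: "T *v p \<noteq> 0" "T *v q \<noteq> 0" "T *v r \<noteq> 0"
    using p q r assms(1) by (simp_all add: matrix_vector_nonzero)
  obtain k where k: "k > 0" "orient P Q R = k * (wedge p q * wedge q r * wedge r p)"
    unfolding p(2) q(2) r(2) using orient_circle_pt[OF p(1) q(1) r(1)] by blast
  obtain l where l: "l > 0" "orient (SL2R_act T P) (SL2R_act T Q) (SL2R_act T R) = l * (wedge p q * wedge q r * wedge r p)"
    unfolding p(2) q(2) r(2) SL2R_act_circle_pt[OF p(1)] SL2R_act_circle_pt[OF q(1)] SL2R_act_circle_pt[OF r(1)]
    using orient_circle_pt[OF nz] assms(1) by (simp add: wedge_mult) blast
  show ?thesis unfolding k(2) l(2) using k(1) l(1) by (simp add: zero_less_mult_iff)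
qed

text \<open>R is to consist of the pairs of lifts of \<rho>1 \<gamma> and \<rho>2 \<gamma> for a
  common \<gamma>. It is a relation because lifts are determined only up to sign and \<rho>1 may
  identify elements that \<rho>2 separates.\<close>

locale order_equivalent_pairs =
  fixes R :: "((real^2^2) \<times> (real^2^2)) set" and a b :: complex
  assumes a: "a \<in> sphere 0 1" and b: "b \<in> sphere 0 1"
    and det_R: "(A, B) \<in> R \<Longrightarrow> det A = 1 \<and> det B = 1"
    and mult_R: "(A, B) \<in> R \<Longrightarrow> (A', B') \<in> R \<Longrightarrow> (A ** A', B ** B') \<in> R"
    and dense1: "{A. det A = 1} \<subseteq> closure (fst ` R)"
    and dense2: "{A. det A = 1} \<subseteq> closure (snd ` R)"
    and orient_R: "(A, A') \<in> R \<Longrightarrow> (B, B') \<in> R \<Longrightarrow> (C, C') \<in> R \<Longrightarrow>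
      sgn (orient (SL2R_act A a) (SL2R_act B a) (SL2R_act C a)) =
      sgn (orient (SL2R_act A' b) (SL2R_act B' b) (SL2R_act C' b))"
begin

definition orbit_pairs :: "(complex \<times> complex) set" where
  "orbit_pairs = (\<lambda>(A, B). (SL2R_act A a, SL2R_act B b)) ` R"

text \<open>The map A \<mapsto> A c is continuous on the matrices of determinant one and, by
  transitivity, maps them onto the circle.\<close>

lemma dense_orbit:
  assumes "c \<in> sphere 0 1" "{A. det A = 1} \<subseteq> closure \<Gamma>"
  shows "sphere 0 1 \<subseteq> closure ((\<lambda>A. SL2R_act A c) ` \<Gamma>)"
proof
  fix p :: complex assume "p \<in> sphere 0 1"
  then obtain A where A: "det A = 1" "SL2R_act A c = p" using SL2R_act_transitive assms(1) by blast
  then have "A \<in> closure \<Gamma>" using assms(2) by blast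
  then obtain M where M: "\<And>n. M n \<in> \<Gamma>" "M \<longlonglongrightarrow> A" unfolding closure_sequential by blast
  have "(\<lambda>n. SL2R_act (M n) c) \<longlonglongrightarrow> SL2R_act A c"
    using A assms(1) by (intro tendsto_SL2R_act M tendsto_const) simp_all
  then show "p \<in> closure ((\<lambda>A. SL2R_act A c) ` \<Gamma>)"
    unfolding closure_sequential using M A by (intro exI[of _ "\<lambda>n. SL2R_act (M n) c"]) auto
qed

sublocale cyclic_dense orbit_pairs
proof
  fix p p' assume "(p, p') \<in> orbit_pairs"
  then show "p \<in> sphere 0 1 \<and> p' \<in> sphere 0 1"
    using det_R a b SL2R_act_in_sphere unfolding orbit_pairs_def by fastforce
next
  fix p p' q q' r r'
  assume "(p, p') \<in> orbit_pairs" "(q, q') \<in> orbit_pairs" "(r, r') \<in> orbit_pairs"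
  then show "sgn (orient p q r) = sgn (orient p' q' r')"
    using orient_R unfolding orbit_pairs_def by auto
next
  have "fst ` orbit_pairs = (\<lambda>A. SL2R_act A a) ` fst ` R" "snd ` orbit_pairs = (\<lambda>A. SL2R_act A b) ` snd ` R"
    by (auto simp: orbit_pairs_def image_image case_prod_unfold)
  then show "sphere 0 1 \<subseteq> closure (fst ` orbit_pairs)" "sphere 0 1 \<subseteq> closure (snd ` orbit_pairs)"
    using dense_orbit[OF a dense1] dense_orbit[OF b dense2] by simp_all
qed

lemma equivariant:
  assumes "(A, B) \<in> R" "(P, Q) \<in> closure orbit_pairs"
  shows "(SL2R_act A P, SL2R_act B Q) \<in> closure orbit_pairs"
proof -
  obtain f g where fg: "\<And>n. (f n, g n) \<in> orbit_pairs" "f \<longlonglongrightarrow> P" "g \<longlonglongrightarrow> Q"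
    by (rule closureE[OF assms(2)]) (rule that)
  have d: "det A \<noteq> 0" "det B \<noteq> 0" using det_R[OF assms(1)] by auto
  have "(SL2R_act A (f n), SL2R_act B (g n)) \<in> orbit_pairs" for n
  proof -
    obtain M N where MN: "(M, N) \<in> R" "f n = SL2R_act M a" "g n = SL2R_act N b"
      using fg(1)[of n] unfolding orbit_pairs_def by auto
    have "SL2R_act A (f n) = SL2R_act (A ** M) a" "SL2R_act B (g n) = SL2R_act (B ** N) b"
      using MN det_R[OF MN(1)] a b by (simp_all add: SL2R_act_mult)
    then show ?thesis
      using mult_R[OF assms(1) MN(1)] unfolding orbit_pairs_def by force
  qed
  moreover have "(\<lambda>n. SL2R_act A (f n)) \<longlonglongrightarrow> SL2R_act A P" "(\<lambda>n. SL2R_act B (g n)) \<longlonglongrightarrow> SL2R_act B Q"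
    using closure_in_sphere[OF assms(2)] d by (intro tendsto_SL2R_act tendsto_const fg; simp)+
  ultimately show ?thesis using closureI closure_subset by (meson subsetD)
qed

text \<open>If \<open>(A\<^sub>n, B\<^sub>n)\<close> lie in \<open>R\<close> and \<open>A\<^sub>n\<close> converges, then a limit of the normalised \<open>B\<^sub>n / \<bar>B\<^sub>n\<bar>\<close> is
  invertible: a limit of rank one would send two distinct points of the circle to the same point.\<close>

lemma conjugate_exists:
  assumes A: "det A = 1"
  shows "\<exists>B. det B = 1 \<and> (\<forall>P Q. (P, Q) \<in> closure orbit_pairs \<longrightarrow>
    (SL2R_act A P, SL2R_act B Q) \<in> closure orbit_pairs)"
proof -
  have "A \<in> closure (fst ` R)" using dense1 A by blast
  then obtain M where M: "\<And>n. M n \<in> fst ` R" "M \<longlonglongrightarrow> A" unfolding closure_sequential by blast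
  have "\<exists>B. (M n, B) \<in> R" for n using M(1)[of n] by auto
  then obtain B where B: "\<And>n. (M n, B n) \<in> R" by metis
  have dB: "det (B n) = 1" for n using det_R B by blast
  then have nB: "B n \<noteq> 0" for n using det_2[of "B n"] by auto
  \<comment> \<open>Scaling leaves the action on the circle unchanged and brings the possibly
    unbounded partners into a compact set.\<close>
  define C where "C n = (1 / norm (B n)) *\<^sub>R B n" for n
  have "C n \<in> sphere 0 1" for n using nB by (simp add: C_def)
  then obtain N r where N: "N \<in> sphere 0 1" and r: "strict_mono r" and lim: "(C \<circ> r) \<longlonglongrightarrow> N"
    using compact_sphere[of "0 :: real^2^2" 1] unfolding compact_def by blast
  have limM: "(M \<circ> r) \<longlonglongrightarrow> A" using LIMSEQ_subseq_LIMSEQ[OF M(2) r] .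
  have "det (C n) = (1 / norm (B n))\<^sup>2 * det (B n)" for n
    by (simp only: C_def det_scaleR_2)
  then have "det (C n) \<ge> 0" for n using dB by simp
  then have dN: "det N \<ge> 0"
    using tendsto_lowerbound[OF tendsto_det_2[OF lim], of 0] by simp
  \<comment> \<open>Outside the kernel of N the limit can be taken even while N might be singular;
    this is what later shows that N is not.\<close>
  have limit: "(SL2R_act A P, circle_pt (N *v v)) \<in> closure orbit_pairs"
    if "(P, circle_pt v) \<in> closure orbit_pairs" "v \<noteq> 0" "N *v v \<noteq> 0" for P v
  proof (rule closureI)
    show "((SL2R_act ((M \<circ> r) n) P), circle_pt ((C \<circ> r) n *v v)) \<in> closure orbit_pairs" for n
    proof -
      have "SL2R_act (B (r n)) (circle_pt v) = SL2R_act (C (r n)) (circle_pt v)"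
        unfolding C_def using nB by (intro SL2R_act_scaleR[symmetric] circle_pt_in_sphere[OF that(2)]) simp
      then show ?thesis using equivariant[OF B[of "r n"] that(1)] that(2) by (simp add: SL2R_act_circle_pt)
    qed
    show "(\<lambda>n. SL2R_act ((M \<circ> r) n) P) \<longlonglongrightarrow> SL2R_act A P"
      using closure_in_sphere[OF that(1)] A by (intro tendsto_SL2R_act limM tendsto_const) auto
    have "(\<lambda>n. (C \<circ> r) n *v v) \<longlonglongrightarrow> N *v v"
    proof (rule vec_tendstoI)
      fix i
      show "(\<lambda>n. ((C \<circ> r) n *v v) $ i) \<longlonglongrightarrow> (N *v v) $ i"
        unfolding matrix_vector_nth_2 by (intro tendsto_intros lim)
    qed
    then show "(\<lambda>n. circle_pt ((C \<circ> r) n *v v)) \<longlonglongrightarrow> circle_pt (N *v v)"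
      using that(3) by (rule tendsto_circle_pt)
  qed
  have "det N \<noteq> 0"
  proof
    assume N0: "det N = 0"
    \<comment> \<open>A singular N maps all lines outside its kernel to a single line, contradicting
      injectivity of the closed relation and of the action of A.\<close>
    have kernel: "N *v v = 0 \<or> N *v w = 0"
      if "(P, circle_pt v) \<in> closure orbit_pairs" "(P', circle_pt w) \<in> closure orbit_pairs"
        "v \<noteq> 0" "w \<noteq> 0" "P \<noteq> P'" for P P' v w
    proof (rule ccontr)
      assume nz: "\<not> ?thesis"
      have "circle_pt (N *v v) = circle_pt (N *v w)"
        using nz N0 by (simp add: circle_pt_eq_iff wedge_mult)
      then have "SL2R_act A P = SL2R_act A P'"
        using limit[OF that(1,3)] limit[OF that(2,4)] nz closure_injective by metis
      then show False
        using that(5) SL2R_act_eq_iff[of A P P'] A closure_in_sphere(1) that(1,2) by auto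
    qed
    have "\<exists>v. (P, circle_pt v) \<in> closure orbit_pairs \<and> v \<noteq> 0" if "P \<in> sphere 0 1" for P
      using closure_total[OF that] closure_in_sphere(2) sphere_circle_ptE by metis
    \<comment> \<open>Any three distinct points would do. Of the three vectors at least two lie in
      the kernel, and they are independent, so N would vanish in spite of its norm 1.\<close>
    then obtain u v w where
        u: "(1, circle_pt u) \<in> closure orbit_pairs" "u \<noteq> 0" and
        v: "(- 1, circle_pt v) \<in> closure orbit_pairs" "v \<noteq> 0" and
        w: "(\<i>, circle_pt w) \<in> closure orbit_pairs" "w \<noteq> 0"
      by (metis mem_sphere_0 norm_one norm_minus_cancel norm_ii)
    have dist: "(1::complex) \<noteq> - 1" "(1::complex) \<noteq> \<i>" "- 1 \<noteq> \<i>"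
      by (auto simp: complex_eq_iff)
    have two: "N = 0"
      if "N *v x = 0" "N *v y = 0" "(P, circle_pt x) \<in> closure orbit_pairs" "(P', circle_pt y) \<in> closure orbit_pairs"
        "x \<noteq> 0" "y \<noteq> 0" "P \<noteq> P'" for x y P P'
    proof -
      have "circle_pt x \<noteq> circle_pt y" using closure_injective that by metis
      then have "wedge x y \<noteq> 0" using that circle_pt_eq_iff by blast
      then show ?thesis using that(1,2) matrix_eq_0_if_kernel by blast
    qed
    have "N = 0"
      using kernel[OF u(1) v(1) u(2) v(2) dist(1)] kernel[OF u(1) w(1) u(2) w(2) dist(2)]
        kernel[OF v(1) w(1) v(2) w(2) dist(3)] two[OF _ _ u(1) v(1) u(2) v(2) dist(1)]
        two[OF _ _ u(1) w(1) u(2) w(2) dist(2)] two[OF _ _ v(1) w(1) v(2) w(2) dist(3)] by blast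
    then show False using N by simp
  qed
  \<comment> \<open>The sign matters: a matrix of negative determinant cannot be rescaled into
    SL(2,\<real>).\<close>
  with dN have pos: "det N > 0" by simp
  define B' where "B' = (1 / sqrt (det N)) *\<^sub>R N"
  have "det B' = (1 / sqrt (det N))\<^sup>2 * det N"
    by (simp only: B'_def det_scaleR_2)
  then have "det B' = 1" using pos by (simp add: power_divide)
  moreover have "(SL2R_act A P, SL2R_act B' Q) \<in> closure orbit_pairs"
    if PQ: "(P, Q) \<in> closure orbit_pairs" for P Q
  proof -
    obtain v where v: "v \<noteq> 0" "Q = circle_pt v"
      using sphere_circle_ptE[OF closure_in_sphere(2)[OF PQ]] .
    have "SL2R_act B' Q = SL2R_act N Q"
      unfolding B'_def using pos by (intro SL2R_act_scaleR closure_in_sphere(2)[OF PQ]) simp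
    also have "\<dots> = circle_pt (N *v v)"
      unfolding v(2) by (rule SL2R_act_circle_pt[OF v(1)])
    finally have "SL2R_act B' Q = circle_pt (N *v v)" .
    then show ?thesis using limit[of P v] PQ v matrix_vector_nonzero[of N v] pos by simp
  qed
  ultimately show ?thesis by blast
qed

text \<open>Once the relation is known to be the graph of some T in SL(2,\<real>), equivariance says
  that T A and B T agree on the circle, hence as matrices up to sign.\<close>

lemma conjugate:
  "\<exists>T. det T = 1 \<and> (\<forall>(A, B)\<in>R. A = T ** B ** adj2 T \<or> A = - (T ** B ** adj2 T))"
proof -
  have S: "pt 1 0 \<in> sphere 0 1" "pt 0 1 \<in> sphere 0 1" "pt 1 1 \<in> sphere 0 1"
    using pt_in_sphere[of 1 0] pt_in_sphere[of 0 1] pt_in_sphere[of 1 1] by simp_all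
  obtain P Q Q3 where PQO: "(pt 1 0, P) \<in> closure orbit_pairs" "(pt 0 1, Q) \<in> closure orbit_pairs"
      "(pt 1 1, Q3) \<in> closure orbit_pairs"
    using closure_total[OF S(1)] closure_total[OF S(2)] closure_total[OF S(3)] by blast
  \<comment> \<open>The triple infinity, 0, 1 is positively oriented, and the relation preserves
    this; hence T exists with determinant one.\<close>
  have "orient P Q Q3 > 0"
    by (rule closure_order[OF PQO]) (simp add: orient_pt_pos_iff)
  then obtain T where T: "det T = 1" "SL2R_act T (pt 1 0) = P" "SL2R_act T (pt 0 1) = Q" "SL2R_act T (pt 1 1) = Q3"
    using SL2R_act_three_points closure_in_sphere(2) PQO by metis
  have adj_T: "SL2R_act (adj2 T) (SL2R_act T P) = P" "SL2R_act T (SL2R_act (adj2 T) P) = P"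
    if "P \<in> sphere 0 1" for P
    using SL2R_act_mult[of T P "adj2 T"] SL2R_act_mult[of "adj2 T" P T] T(1) that
    by (simp_all add: mult_adj2 SL2R_act_one)
  have T_sphere: "SL2R_act T P \<in> sphere 0 1" "SL2R_act (adj2 T) P \<in> sphere 0 1"
    if "P \<in> sphere 0 1" for P
    using that T(1) SL2R_act_in_sphere by simp_all
  \<comment> \<open>The closed relation followed by the inverse of T, so that infinity, 0 and 1 are
    related to themselves.\<close>
  define K where "K P Q \<longleftrightarrow> Q \<in> sphere 0 1 \<and> (P, SL2R_act T Q) \<in> closure orbit_pairs" for P Q
  have K: "K P P" if P: "P \<in> sphere 0 1" for P
  proof (rule normalising_relation_id[of K])
    show "P \<in> sphere 0 1 \<and> Q \<in> sphere 0 1" if "K P Q" for P Q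
      using that closure_in_sphere unfolding K_def by blast
    show "\<exists>Q. K P Q" if "P \<in> sphere 0 1" for P
      using closure_total[OF that] adj_T T_sphere closure_in_sphere(2) unfolding K_def by metis
    show "\<exists>P. K P Q" if "Q \<in> sphere 0 1" for Q
      using closure_surjective T_sphere that unfolding K_def by blast
    show "Q = Q'" if "K P Q" "K P Q'" for P Q Q'
      using closure_functional that adj_T(1) unfolding K_def by metis
    show "P = P'" if "K P Q" "K P' Q" for P P' Q
      using closure_injective that unfolding K_def by blast
    show "orient P' Q' R' > 0" if "K P P'" "K Q Q'" "K R R'" "orient P Q R > 0" for P P' Q Q' R R'
      using closure_order[of P _ Q _ R] orient_SL2R_act_pos_iff[OF T(1)] that unfolding K_def by blast
    show "K (pt 1 0) (pt 1 0)" "K (pt 0 1) (pt 0 1)" "K (pt 1 1) (pt 1 1)"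
      using PQO T S unfolding K_def by simp_all
    show "\<exists>B. det B = 1 \<and> (\<forall>P Q. K P Q \<longrightarrow> K (SL2R_act A P) (SL2R_act B Q))" if A: "det A = 1" for A
    proof -
      obtain B where B: "det B = 1" "\<And>P Q. (P, Q) \<in> closure orbit_pairs \<Longrightarrow>
          (SL2R_act A P, SL2R_act B Q) \<in> closure orbit_pairs"
        using conjugate_exists[OF A] by blast
      have "K (SL2R_act A P) (SL2R_act (adj2 T ** B ** T) Q)" if "K P Q" for P Q
      proof -
        have Q: "Q \<in> sphere 0 1" and PQ: "(P, SL2R_act T Q) \<in> closure orbit_pairs"
          using that unfolding K_def by auto
        have "SL2R_act (adj2 T ** B ** T) Q = SL2R_act (adj2 T) (SL2R_act B (SL2R_act T Q))"
          using Q T_sphere[OF Q] T(1) B(1) by (simp add: SL2R_act_mult)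
        moreover have "SL2R_act B (SL2R_act T Q) \<in> sphere 0 1"
          using T_sphere(1)[OF Q] B(1) SL2R_act_in_sphere by simp
        ultimately show ?thesis
          using B(2)[OF PQ] adj_T(2) T_sphere(2) unfolding K_def by metis
      qed
      moreover have "det (adj2 T ** B ** T) = 1" using T(1) B(1) by (simp add: det_mul)
      ultimately show ?thesis by blast
    qed
  qed (rule P)
  have "A = adj2 T ** B ** adj2 (adj2 T) \<or> A = - (adj2 T ** B ** adj2 (adj2 T))" if AB: "(A, B) \<in> R" for A B
  proof -
    have d: "det A = 1" "det B = 1" using det_R[OF AB] by auto
    have "SL2R_act (T ** A) P = SL2R_act (B ** T) P" if P: "P \<in> sphere 0 1" for P
    proof -
      have "(SL2R_act A P, SL2R_act B (SL2R_act T P)) \<in> closure orbit_pairs"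
        using equivariant[OF AB] K[OF P] unfolding K_def by blast
      moreover have "(SL2R_act A P, SL2R_act T (SL2R_act A P)) \<in> closure orbit_pairs"
        using K[of "SL2R_act A P"] SL2R_act_in_sphere[of A P] d P unfolding K_def by simp
      ultimately have "SL2R_act B (SL2R_act T P) = SL2R_act T (SL2R_act A P)"
        using closure_functional by blast
      then show ?thesis using P d T(1) by (simp add: SL2R_act_mult)
    qed
    then have "T ** A = B ** T \<or> T ** A = - (B ** T)"
      using d T(1) by (intro SL2R_act_eq_imp) (simp_all add: det_mul)
    moreover have "A = adj2 T ** (T ** A)" using T(1) by (simp add: matrix_mul_assoc mult_adj2)
    ultimately have "A = adj2 T ** (B ** T) \<or> A = adj2 T ** (- (B ** T))"
      by auto
    then have "A = adj2 T ** B ** T \<or> A = - (adj2 T ** B ** T)"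
      by (simp only: bounded_bilinear.minus_right[OF bounded_bilinear_matrix_mult] matrix_mul_assoc)
    moreover have "adj2 (adj2 T) = T" by (simp add: adj2_def matrix_eq_2)
    ultimately show ?thesis by simp
  qed
  \<comment> \<open>T leads from the first circle to the second, so its inverse conjugates the
    second component of R into the first.\<close>
  then show ?thesis using T(1) by (intro exI[of _ "adj2 T"]) auto
qed

end

section \<open>Elementary subgroups\<close>

lemma singular_kernel:
  fixes A :: "real^2^2"
  assumes "det A = 0"
  shows "\<exists>v. v \<noteq> 0 \<and> A *v v = 0"
proof -
  have "\<not> invertible A" using assms invertible_det_nz by blast
  then show ?thesis using matrix_left_invertible_ker invertible_left_inverse by blast
qed

text \<open>The kernel of X is a line. From M X = c X M with c \<noteq> 0, every M preserves it, and
  the corresponding boundary point is fixed.\<close>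

lemma common_kernel_fixed:
  assumes X: "X \<noteq> 0" "det X = 0"
    and M: "\<And>M. M \<in> \<Gamma> \<Longrightarrow> det M = 1 \<and> (\<exists>c. M ** X = c *\<^sub>R (X ** M))"
  shows "\<exists>p\<in>sphere 0 1. \<forall>M\<in>\<Gamma>. SL2R_act M p = p"
proof -
  obtain v where v: "v \<noteq> 0" "X *v v = 0" using singular_kernel[OF X(2)] by blast
  have "SL2R_act M (circle_pt v) = circle_pt v" if MG: "M \<in> \<Gamma>" for M
  proof -
    obtain c where c: "M ** X = c *\<^sub>R (X ** M)" and d: "det M = 1" using M[OF MG] by blast
    have "c \<noteq> 0"
    proof
      assume "c = 0"
      then have "adj2 M ** (M ** X) = adj2 M ** 0" using c by simp
      then show False
        using X(1) d by (simp add: matrix_mul_assoc mult_adj2 bounded_bilinear.zero_right[OF bounded_bilinear_matrix_mult])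
    qed
    have "c *\<^sub>R (X *v (M *v v)) = (c *\<^sub>R (X ** M)) *v v"
      by (simp add: scaleR_matrix_vector_assoc matrix_vector_mul_assoc)
    also have "\<dots> = M *v (X *v v)" by (simp add: c[symmetric] matrix_vector_mul_assoc)
    finally have "X *v (M *v v) = 0" using v(2) \<open>c \<noteq> 0\<close> by simp
    then have "wedge (M *v v) v = 0" using matrix_eq_0_if_kernel v(2) X(1) by blast
    then show ?thesis
      using v(1) d by (simp add: SL2R_act_circle_pt circle_pt_eq_iff matrix_vector_nonzero)
  qed
  then show ?thesis using circle_pt_in_sphere[OF v(1)] by blast
qed

lemma conj_eigenvalue:
  fixes M X :: "real^2^2"
  assumes "det M = 1" "M ** X = c *\<^sub>R (X ** M)" "det X \<noteq> 0"
  shows "c = 1 \<or> c = - 1"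
proof -
  have "det (M ** X) = c\<^sup>2 * det (X ** M)" using assms(2) by (simp add: det_scaleR_2)
  then have "c\<^sup>2 = 1" using assms(1,3) by (simp add: det_mul)
  then show ?thesis by (simp add: power2_eq_1_iff)
qed

text \<open>X has real eigenvalues l and -l, and its eigenlines are the ends of an axis. As c is 1
  or -1, M maps eigenvectors for k to eigenvectors for c k, so it preserves or exchanges the two
  lines.\<close>

lemma common_axis_invariant:
  assumes X: "X$2$2 = - X$1$1" "det X < 0"
    and M: "\<And>M. M \<in> \<Gamma> \<Longrightarrow> det M = 1 \<and> (\<exists>c. M ** X = c *\<^sub>R (X ** M))"
  shows "\<exists>p\<in>sphere 0 1. \<exists>q\<in>sphere 0 1. p \<noteq> q \<and> (\<forall>M\<in>\<Gamma>. SL2R_act M ` {p, q} = {p, q})"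
proof -
  define l where "l = sqrt (- det X)"
  have l: "l > 0" "l * l = - det X" using X(2) by (simp_all add: l_def)
  have eig: "\<exists>v. v \<noteq> 0 \<and> X *v v = k *\<^sub>R v" if "k * k = - det X" for k
  proof -
    \<comment> \<open>The characteristic polynomial of a traceless matrix is k^2 + det X.\<close>
    have "det (X - mat k) = 0"
      using that X(1) by (simp add: det_2 mat_nth algebra_simps)
    then obtain v where "v \<noteq> 0" "(X - mat k) *v v = 0" using singular_kernel by blast
    then show ?thesis
      by (intro exI[of _ v]) (simp add: vec_eq_iff forall_2 matrix_vector_nth_2 mat_nth algebra_simps)
  qed
  obtain u where u: "u \<noteq> 0" "X *v u = l *\<^sub>R u" using eig l(2) by blast
  obtain v where v: "v \<noteq> 0" "X *v v = (- l) *\<^sub>R v" using eig[of "- l"] l(2) by auto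
  have unique: "circle_pt w = circle_pt w'"
    if "w \<noteq> 0" "w' \<noteq> 0" "X *v w = k *\<^sub>R w" "X *v w' = k *\<^sub>R w'" "k \<noteq> 0" for w w' k
  proof (rule ccontr)
    assume "circle_pt w \<noteq> circle_pt w'"
    then have "wedge w w' \<noteq> 0" using that by (simp add: circle_pt_eq_iff)
    moreover have "(X - mat k) *v w = 0" "(X - mat k) *v w' = 0"
      using that by (simp_all add: vec_eq_iff forall_2 matrix_vector_nth_2 mat_nth algebra_simps)
    ultimately have "X - mat k = 0" using matrix_eq_0_if_kernel by blast
    then show False using X(1) that(5) by (simp add: matrix_simps_2)
  qed
  have neq: "circle_pt u \<noteq> circle_pt v"
  proof
    assume "circle_pt u = circle_pt v"
    then obtain c where c: "v = c *\<^sub>R u" using u v wedge_eq_0_scaleR circle_pt_eq_iff by metis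
    have "X *v v = l *\<^sub>R v" using u(2) unfolding c by (simp add: matrix_vector_mult_scaleR mult.commute)
    then have "l *\<^sub>R v = (- l) *\<^sub>R v" using v(2) by simp
    then have "l = - l" using v(1) by (simp only: scaleR_cancel_right) blast
    then show False using l(1) by simp
  qed
  have step: "SL2R_act M (circle_pt w) \<in> {circle_pt u, circle_pt v}"
    if MG: "M \<in> \<Gamma>" and that: "w \<noteq> 0" "X *v w = k *\<^sub>R w" "k = l \<or> k = - l" for M w k
  proof -
    obtain c where c: "M ** X = c *\<^sub>R (X ** M)" and d: "det M = 1" using M[OF MG] by blast
    have c1: "c = 1 \<or> c = - 1" using conj_eigenvalue[OF d c] X(2) by simp
    have Mw: "M *v w \<noteq> 0" using d that(1) by (simp add: matrix_vector_nonzero)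
    have "c *\<^sub>R (X *v (M *v w)) = (c *\<^sub>R (X ** M)) *v w"
      by (simp add: scaleR_matrix_vector_assoc matrix_vector_mul_assoc)
    also have "\<dots> = M *v (X *v w)" by (simp add: c[symmetric] matrix_vector_mul_assoc)
    also have "\<dots> = k *\<^sub>R (M *v w)" by (simp add: that(2) matrix_vector_mult_scaleR)
    finally have "c *\<^sub>R (c *\<^sub>R (X *v (M *v w))) = c *\<^sub>R (k *\<^sub>R (M *v w))" by simp
    then have "X *v (M *v w) = (c * k) *\<^sub>R (M *v w)" using c1 by auto
    moreover have "c * k = l \<or> c * k = - l" using c1 that(3) by auto
    ultimately have "X *v (M *v w) = l *\<^sub>R (M *v w) \<or> X *v (M *v w) = (- l) *\<^sub>R (M *v w)"
      by metis
    then have "circle_pt (M *v w) = circle_pt u \<or> circle_pt (M *v w) = circle_pt v"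
      using unique[OF Mw u(1) _ u(2)] unique[OF Mw v(1) _ v(2)] l(1) by fastforce
    then show ?thesis using that(1) by (simp add: SL2R_act_circle_pt)
  qed
  have "SL2R_act M ` {circle_pt u, circle_pt v} = {circle_pt u, circle_pt v}" if MG: "M \<in> \<Gamma>" for M
  proof -
    have "SL2R_act M (circle_pt u) \<in> {circle_pt u, circle_pt v}" "SL2R_act M (circle_pt v) \<in> {circle_pt u, circle_pt v}"
      using step[OF MG u] step[OF MG v] by simp_all
    moreover have "SL2R_act M (circle_pt u) \<noteq> SL2R_act M (circle_pt v)"
      using SL2R_act_eq_iff[of M "circle_pt u" "circle_pt v"] M[OF MG] circle_pt_in_sphere u(1) v(1) neq by simp
    ultimately show ?thesis by auto
  qed
  then show ?thesis using circle_pt_in_sphere u(1) v(1) neq by blast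
qed

text \<open>X acts on the upper half-plane as a rotation with a single fixed point z, and every M
  commuting with X must fix z as well.\<close>

lemma common_centre_fixed:
  assumes X: "X$2$2 = - X$1$1" "det X > 0"
    and M: "\<And>M. M \<in> \<Gamma> \<Longrightarrow> det M = 1 \<and> (\<exists>c. M ** X = c *\<^sub>R (X ** M))"
  shows "\<exists>p\<in>ball 0 1. \<forall>M\<in>\<Gamma>. SL2R_act M p = p"
proof -
  define a b e s where "a = X$1$1" and "b = X$1$2" and "e = X$2$1" and "s = sqrt (det X)"
  have d: "det X = - (a * a) - b * e" by (simp add: det_2 X(1) a_def b_def e_def)
  have s: "s > 0" "s * s = - (a * a) - b * e" using X(2) d by (auto simp: s_def)
  have e0: "e \<noteq> 0"
  proof
    assume "e = 0"
    then have "s * s \<le> 0" using s(2) by simp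
    then show False using s(1) by (simp add: mult_le_0_iff)
  qed
  \<comment> \<open>A root of e z^2 - 2 a z - b = 0, the fixed point equation of z \<mapsto> (a z +
    b) / (e z - a); the absolute value selects the root in the upper half-plane.\<close>
  define z where "z = Complex (a / e) (s / \<bar>e\<bar>)"
  have Im_z: "Im z > 0" using s(1) e0 by (simp add: z_def)
  have root: "of_real e * z\<^sup>2 - of_real (2 * a) * z - of_real b = 0"
  proof -
    have "e * ((a / e)\<^sup>2 - (s / \<bar>e\<bar>)\<^sup>2) - 2 * a * (a / e) - b = (- (s * s) - a * a - b * e) / e"
      using e0 by (simp add: power_divide power2_eq_square field_simps)
    then have "e * ((a / e)\<^sup>2 - (s / \<bar>e\<bar>)\<^sup>2) - 2 * a * (a / e) - b = 0" using s(2) by simp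
    then show ?thesis
      using e0 by (simp add: complex_eq_iff z_def power2_eq_square)
  qed
  have z_i: "z + \<i> \<noteq> 0" using Im_z by (auto simp: complex_eq_iff)
  have "SL2R_act M (cayley z) = cayley z" if MG: "M \<in> \<Gamma>" for M
  proof -
    obtain c where c: "M ** X = c *\<^sub>R (X ** M)" and dM: "det M = 1" using M[OF MG] by blast
    define p q r t where "p = M$1$1" and "q = M$1$2" and "r = M$2$1" and "t = M$2$2"
    have pt: "p * t - q * r = 1" using dM by (simp add: det_2 p_def q_def r_def t_def)
    have eqs: "p * a + q * e = c * (a * p + b * r)" "p * b - q * a = c * (a * q + b * t)"
      "r * a + t * e = c * (e * p - a * r)" "r * b - t * a = c * (e * q - a * t)"
      using c X(1) unfolding matrix_simps_2 a_def b_def e_def p_def q_def r_def t_def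
      by (simp_all add: matrix_mult_nth_2)
    have "c = 1"
    proof (rule ccontr)
      assume "c \<noteq> 1"
      then have "c = - 1" using conj_eigenvalue[OF dM c] X(2) by simp
      \<comment> \<open>Conjugation by M would take X to -X. With determinant one this leads to a
        sum of two squares equal to -(e * e).\<close>
      with eqs have e1: "2 * (a * p) + q * e + b * r = 0" and e2: "e * (t + p) = 0"
        by (simp_all add: algebra_simps)
      then have t: "t = - p" using e0 by simp
      have "q * e = - (2 * (a * p)) - b * r" using e1 by simp
      then have "e * (e * (p * p)) - 2 * (e * (a * (p * r))) - e * (b * (r * r)) = - (e * e) * (p * t - q * r)"
        unfolding t by (simp add: algebra_simps) algebra
      then have "(e * p - a * r) * (e * p - a * r) + s * s * (r * r) = - (e * e)"
        unfolding pt s(2) by (simp add: algebra_simps)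
      moreover have "(e * p - a * r) * (e * p - a * r) + s * s * (r * r) \<ge> 0" by simp
      moreover have "e * e > 0" using e0 by (simp add: zero_less_mult_iff) linarith
      ultimately show False by linarith
    qed
    with eqs have e1: "q * e = b * r" and e2: "e * (p - t) = 2 * a * r"
      by (simp_all add: algebra_simps)
    \<comment> \<open>Commuting with X makes the fixed point quadratic of M proportional to that of
      X, so they share the root z.\<close>
    have "of_real e * (of_real r * z\<^sup>2 + of_real (t - p) * z - of_real q)
        = of_real r * (of_real e * z\<^sup>2) - of_real (e * (p - t)) * z - of_real (q * e)"
      by (simp add: algebra_simps)
    also have "\<dots> = of_real r * (of_real e * z\<^sup>2 - of_real (2 * a) * z - of_real b)"
      unfolding e1 e2 by (simp add: algebra_simps)
    finally have "of_real r * z\<^sup>2 + of_real (t - p) * z - of_real q = 0"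
      using root e0 by simp
    then have "of_real p * z + of_real q = z * (of_real r * z + of_real t)"
      by (simp add: algebra_simps power2_eq_square)
    moreover have den: "of_real r * z + of_real t \<noteq> 0"
    proof
      assume 0: "of_real r * z + of_real t = 0"
      then have "r * Im z = 0" by (simp add: complex_eq_iff)
      then have "r = 0" using Im_z by simp
      then show False using 0 pt by simp
    qed
    ultimately have "(of_real p * z + of_real q) / (of_real r * z + of_real t) = z" by simp
    then show ?thesis
      using SL2R_act_cayley[OF z_i, of M] den unfolding p_def q_def r_def t_def by simp
  qed
  moreover have "cayley z \<in> ball 0 1"
  proof -
    have "(cmod (z - \<i>))\<^sup>2 < (cmod (z + \<i>))\<^sup>2"
      unfolding cmod_power2 using Im_z by (simp add: power2_eq_square algebra_simps)
    then have "cmod (z - \<i>) < cmod (z + \<i>)" by (rule power_less_imp_less_base) simp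
    then show ?thesis using z_i by (simp add: cayley_def norm_divide)
  qed
  ultimately show ?thesis by blast
qed

section \<open>Representations in \<open>PSL(2,\<real>)\<close>\<close>

lemma det_one_uminus: "det A = 1 \<Longrightarrow> det (- A) = 1" for A :: "real^2^2"
  by (simp add: det_minus_2)

lemma PSL2R_act_lift: "PSL2R_act {A, - A} z = SL2R_act A z"
  using PSL2R_act_coset[of A z] by (simp add: coset_SL2R)

lemma PSL2R_mult:
  assumes "det A = 1" "det B = 1"
  shows "{A, - A} \<otimes>\<^bsub>PSL2R\<^esub> {B, - B} = {A ** B, - (A ** B)}"
proof -
  have "{A, - A} \<otimes>\<^bsub>PSL2R\<^esub> {B, - B} = ({mat 1, - mat 1} #>\<^bsub>SL2R\<^esub> A) <#>\<^bsub>SL2R\<^esub> ({mat 1, - mat 1} #>\<^bsub>SL2R\<^esub> B)"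
    by (simp add: PSL2R_def FactGroup_def coset_SL2R)
  also have "\<dots> = {mat 1, - mat 1} #>\<^bsub>SL2R\<^esub> (A \<otimes>\<^bsub>SL2R\<^esub> B)"
    using assms by (intro normal.rcos_sum[OF normal_SL2R]) (simp_all add: carrier_SL2R)
  also have "\<dots> = {A ** B, - (A ** B)}" by (simp add: coset_SL2R) (simp add: SL2R_def)
  finally show ?thesis .
qed

lemma PSL2R_one: "\<one>\<^bsub>PSL2R\<^esub> = {mat 1, - mat 1}"
  by (simp add: PSL2R_def FactGroup_def)

lemma PSL2R_memI: "det A = 1 \<Longrightarrow> {A, - A} \<in> carrier PSL2R"
  by (auto simp: carrier_PSL2R)

lemma PSL2R_inv:
  assumes "det A = 1"
  shows "inv\<^bsub>PSL2R\<^esub> {A, - A} = {adj2 A, - adj2 A}"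
  using assms by (intro group.inv_equality[OF group_PSL2R])
    (simp_all add: PSL2R_mult PSL2R_one mult_adj2 PSL2R_memI)

definition lifts :: "('g, 'm) monoid_scheme \<Rightarrow> ('g \<Rightarrow> (real^2^2) set) \<Rightarrow> (real^2^2) set" where
  "lifts G \<rho> = {A. {A, - A} \<in> \<rho> ` carrier G}"

locale PSL2R_rep =
  fixes G :: "('g, 'm) monoid_scheme" (structure) and \<rho> :: "'g \<Rightarrow> (real^2^2) set"
  assumes group_G: "group G" and hom: "\<rho> \<in> hom G PSL2R"
begin

sublocale group_hom G PSL2R \<rho>
  using group_G group_PSL2R hom by (simp add: group_hom_def group_hom_axioms_def)

lemma det_lift:
  assumes "\<gamma> \<in> carrier G" "\<rho> \<gamma> = {A, - A}"
  shows "det A = 1"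
proof -
  have "{A, - A} \<in> carrier PSL2R" using hom_closed[OF assms(1)] assms(2) by simp
  then obtain B where "{A, - A} = {B, - B}" "det B = 1" by (auto simp: carrier_PSL2R)
  then show ?thesis using det_one_uminus by (auto simp: doubleton_eq_iff)
qed

lemma lift_exists:
  assumes "\<gamma> \<in> carrier G"
  shows "\<exists>A. \<rho> \<gamma> = {A, - A}"
  using hom_closed[OF assms] by (auto simp: carrier_PSL2R)

lemma lift_mult:
  assumes "\<gamma> \<in> carrier G" "\<rho> \<gamma> = {A, - A}" "\<delta> \<in> carrier G" "\<rho> \<delta> = {B, - B}"
  shows "\<rho> (\<gamma> \<otimes> \<delta>) = {A ** B, - (A ** B)}"
  using assms det_lift by (simp add: PSL2R_mult)

sublocale lifts: SL2_subgroup "lifts G \<rho>"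
proof
  fix A assume "A \<in> lifts G \<rho>"
  then obtain \<gamma> where g: "\<gamma> \<in> carrier G" "\<rho> \<gamma> = {A, - A}" by (auto simp: lifts_def)
  then show "det A = 1" by (rule det_lift)
  have "\<rho> (inv \<gamma>) = {adj2 A, - adj2 A}" using g det_lift by (simp add: PSL2R_inv)
  then show "adj2 A \<in> lifts G \<rho>" using g unfolding lifts_def by (auto intro!: image_eqI[of _ _ "inv \<gamma>"])
  fix B assume "B \<in> lifts G \<rho>"
  then obtain \<delta> where "\<delta> \<in> carrier G" "\<rho> \<delta> = {B, - B}" by (auto simp: lifts_def)
  then show "A ** B \<in> lifts G \<rho>"
    using lift_mult[OF g] g unfolding lifts_def by (auto intro!: image_eqI[of _ _ "\<gamma> \<otimes> \<delta>"])
next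
  show "mat 1 \<in> lifts G \<rho>"
    unfolding lifts_def using hom_one by (auto simp: PSL2R_one intro!: image_eqI[of _ _ "\<one>"])
qed

text \<open>If the identity were the only lift within distance e of I, translating this
  neighbourhood would isolate every point of the image.\<close>

lemma nondiscrete_small_lift:
  assumes "\<not> discrete_rep G \<rho>" "e > 0"
  shows "\<exists>A\<in>lifts G \<rho>. A \<noteq> mat 1 \<and> norm (A - mat 1) < e"
proof (rule ccontr)
  assume "\<not> ?thesis"
  then have only: "A = mat 1" if "A \<in> lifts G \<rho>" "norm (A - mat 1) < e" for A
    using that by blast
  have top: "topspace PSL2R_topology = carrier PSL2R"
    using quotient_map_PSL2R unfolding quotient_map_def by (simp add: coset_SL2R carrier_PSL2R carrier_SL2R)
  have "openin (subtopology PSL2R_topology (\<rho> ` carrier G)) {P}" if PG: "P \<in> \<rho> ` carrier G" for P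
  proof -
    obtain B where B: "P = {B, - B}" "B \<in> lifts G \<rho>"
      using PG lift_exists unfolding lifts_def by force
    have dB: "det B = 1" using lifts.det_one B(2) .
    \<comment> \<open>The image in the quotient of the ball of radius e about I, translated by B.
      Its preimage is open, being given by the strict inequality for A or for -A.\<close>
    define U where "U = {Q \<in> carrier PSL2R. \<exists>A\<in>Q. norm (adj2 B ** A - mat 1) < e}"
    have cont: "continuous_on UNIV (\<lambda>A. norm (adj2 B ** A - mat 1))"
      "continuous_on UNIV (\<lambda>A. norm (adj2 B ** (- A) - mat 1))"
      by (intro continuous_intros bounded_bilinear.continuous_on[OF bounded_bilinear_matrix_mult])+
    have "open {A. norm (adj2 B ** A - mat 1) < e \<or> norm (adj2 B ** (- A) - mat 1) < e}"
      using cont by (intro open_Collect_disj open_Collect_less continuous_on_const)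
    moreover have "{A \<in> topspace (top_of_set (carrier SL2R)). {mat 1, - mat 1} #>\<^bsub>SL2R\<^esub> A \<in> U}
        = carrier SL2R \<inter> {A. norm (adj2 B ** A - mat 1) < e \<or> norm (adj2 B ** (- A) - mat 1) < e}"
      by (auto simp: coset_SL2R U_def carrier_SL2R PSL2R_memI)
    ultimately have "openin (top_of_set (carrier SL2R))
        {A \<in> topspace (top_of_set (carrier SL2R)). {mat 1, - mat 1} #>\<^bsub>SL2R\<^esub> A \<in> U}"
      by (simp only: openin_open_Int)
    moreover have "U \<subseteq> topspace PSL2R_topology" using top by (auto simp: U_def)
    ultimately have "openin PSL2R_topology U"
      using quotient_map_PSL2R unfolding quotient_map_def by blast
    moreover have "{P} = U \<inter> \<rho> ` carrier G"
    proof (intro equalityI subsetI)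
      fix Q assume "Q \<in> {P}"
      then show "Q \<in> U \<inter> \<rho> ` carrier G"
        using PG B dB assms(2) unfolding U_def by (auto simp: PSL2R_memI mult_adj2)
    next
      fix Q assume Q: "Q \<in> U \<inter> \<rho> ` carrier G"
      then obtain A where A: "A \<in> Q" "norm (adj2 B ** A - mat 1) < e" unfolding U_def by blast
      obtain A' where "Q = {A', - A'}" using Q lift_exists by blast
      then have QA: "Q = {A, - A}" using A(1) by auto
      then have "A \<in> lifts G \<rho>" using Q unfolding lifts_def by blast
      then have "adj2 B ** A = mat 1"
        using only A(2) lifts.mult_mem lifts.adj2_mem B(2) by blast
      then have "B ** (adj2 B ** A) = B" by simp
      then have "A = B" using dB by (simp add: matrix_mul_assoc mult_adj2)
      then show "Q \<in> {P}" using QA B(1) by simp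
    qed
    ultimately show ?thesis unfolding openin_subtopology by blast
  qed
  moreover have "topspace (subtopology PSL2R_topology (\<rho> ` carrier G)) = \<rho> ` carrier G"
    unfolding topspace_subtopology top using hom_closed by blast
  ultimately have "discrete_topology (\<rho> ` carrier G) = subtopology PSL2R_topology (\<rho> ` carrier G)"
    by (subst discrete_topology_unique) blast
  then show False using assms(1) by (simp add: discrete_rep_def)
qed

lemma common_eigenvector_elementary:
  assumes X: "X \<noteq> 0" "X$2$2 = - X$1$1"
    and M: "\<And>M. M \<in> lifts G \<rho> \<Longrightarrow> \<exists>c. M ** X = c *\<^sub>R (X ** M)"
  shows "elementary_rep G \<rho>"
proof -
  have act: "\<exists>M\<in>lifts G \<rho>. PSL2R_act (\<rho> \<gamma>) = SL2R_act M" if g: "\<gamma> \<in> carrier G" for \<gamma>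
  proof -
    obtain A where "\<rho> \<gamma> = {A, - A}" using lift_exists[OF g] by blast
    then show ?thesis using g unfolding lifts_def
      by (intro bexI[of _ A]) (auto simp: PSL2R_act_lift fun_eq_iff intro!: image_eqI[of _ _ \<gamma>])
  qed
  have M': "det M = 1 \<and> (\<exists>c. M ** X = c *\<^sub>R (X ** M))" if "M \<in> lifts G \<rho>" for M
    using that M lifts.det_one by blast
  consider "det X = 0" | "det X < 0" | "det X > 0" by linarith
  then show ?thesis
  proof cases
    case 1
    obtain p where p: "p \<in> sphere 0 1" "\<And>M. M \<in> lifts G \<rho> \<Longrightarrow> SL2R_act M p = p"
      using common_kernel_fixed[OF X(1) 1 M', of "lifts G \<rho>"] by blast
    then have "has_global_fixed_point G \<rho>"
      unfolding has_global_fixed_point_def using act by (metis UnCI)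
    then show ?thesis by (simp add: elementary_rep_def)
  next
    case 2
    obtain p q where p: "p \<in> sphere 0 1" "q \<in> sphere 0 1" "p \<noteq> q"
        "\<And>M. M \<in> lifts G \<rho> \<Longrightarrow> SL2R_act M ` {p, q} = {p, q}"
      using common_axis_invariant[OF X(2) 2 M', of "lifts G \<rho>"] by blast
    then have "has_invariant_boundary_pair G \<rho>"
      unfolding has_invariant_boundary_pair_def using act by metis
    then show ?thesis by (simp add: elementary_rep_def)
  next
    case 3
    obtain p where p: "p \<in> ball 0 1" "\<And>M. M \<in> lifts G \<rho> \<Longrightarrow> SL2R_act M p = p"
      using common_centre_fixed[OF X(2) 3 M', of "lifts G \<rho>"] by blast
    then have "has_global_fixed_point G \<rho>"
      unfolding has_global_fixed_point_def using act by (metis UnCI)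
    then show ?thesis by (simp add: elementary_rep_def)
  qed
qed

lemma lifts_dense:
  assumes "\<not> discrete_rep G \<rho>" "\<not> elementary_rep G \<rho>"
  shows "{A. det A = 1} \<subseteq> closure (lifts G \<rho>)"
  using lifts.dense_or_common_eigenvector[OF nondiscrete_small_lift[OF assms(1)]]
    common_eigenvector_elementary assms(2) by blast

end

lemma conjugate_if_order_equivalent:
  assumes reps: "PSL2R_rep G \<rho>\<^sub>1" "PSL2R_rep G \<rho>\<^sub>2"
    and nondiscrete: "\<not> discrete_rep G \<rho>\<^sub>1" "\<not> discrete_rep G \<rho>\<^sub>2"
    and nonelementary: "\<not> elementary_rep G \<rho>\<^sub>1" "\<not> elementary_rep G \<rho>\<^sub>2"
    and a: "a\<^sub>1 \<in> sphere 0 1" "a\<^sub>2 \<in> sphere 0 1"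
    and order: "\<And>\<alpha> \<beta> \<gamma>. \<alpha> \<in> carrier G \<Longrightarrow> \<beta> \<in> carrier G \<Longrightarrow> \<gamma> \<in> carrier G \<Longrightarrow>
      cyc_order (PSL2R_act (\<rho>\<^sub>1 \<alpha>) a\<^sub>1) (PSL2R_act (\<rho>\<^sub>1 \<beta>) a\<^sub>1) (PSL2R_act (\<rho>\<^sub>1 \<gamma>) a\<^sub>1) =
      cyc_order (PSL2R_act (\<rho>\<^sub>2 \<alpha>) a\<^sub>2) (PSL2R_act (\<rho>\<^sub>2 \<beta>) a\<^sub>2) (PSL2R_act (\<rho>\<^sub>2 \<gamma>) a\<^sub>2)"
  shows "\<exists>A\<in>carrier PSL2R. \<forall>\<gamma>\<in>carrier G. \<rho>\<^sub>1 \<gamma> = A \<otimes>\<^bsub>PSL2R\<^esub> \<rho>\<^sub>2 \<gamma> \<otimes>\<^bsub>PSL2R\<^esub> inv\<^bsub>PSL2R\<^esub> A"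
proof -
  interpret r1: PSL2R_rep G \<rho>\<^sub>1 by (rule reps)
  interpret r2: PSL2R_rep G \<rho>\<^sub>2 by (rule reps)
  \<comment> \<open>All sign combinations of the two lifts are included, so R is closed under
    products without any coherent choice of lifts.\<close>
  define R where "R = {(A, B). \<exists>\<gamma>\<in>carrier G. \<rho>\<^sub>1 \<gamma> = {A, - A} \<and> \<rho>\<^sub>2 \<gamma> = {B, - B}}"
  have RE: "\<exists>\<gamma>\<in>carrier G. \<rho>\<^sub>1 \<gamma> = {A, - A} \<and> \<rho>\<^sub>2 \<gamma> = {B, - B}" if "(A, B) \<in> R" for A B
    using that unfolding R_def by blast
  have det_R: "det A = 1 \<and> det B = 1" if "(A, B) \<in> R" for A B
    using RE[OF that] r1.det_lift r2.det_lift by blast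
  have "lifts G \<rho>\<^sub>1 \<subseteq> fst ` R"
  proof
    fix A assume "A \<in> lifts G \<rho>\<^sub>1"
    then obtain \<gamma> where g: "\<gamma> \<in> carrier G" "\<rho>\<^sub>1 \<gamma> = {A, - A}" unfolding lifts_def by auto
    obtain B where "\<rho>\<^sub>2 \<gamma> = {B, - B}" using r2.lift_exists[OF g(1)] by blast
    with g have "(A, B) \<in> R" unfolding R_def by blast
    then show "A \<in> fst ` R" by force
  qed
  then have dense1: "{A. det A = 1} \<subseteq> closure (fst ` R)"
    using r1.lifts_dense[OF nondiscrete(1) nonelementary(1)] closure_mono by blast
  have "lifts G \<rho>\<^sub>2 \<subseteq> snd ` R"
  proof
    fix B assume "B \<in> lifts G \<rho>\<^sub>2"
    then obtain \<gamma> where g: "\<gamma> \<in> carrier G" "\<rho>\<^sub>2 \<gamma> = {B, - B}" unfolding lifts_def by auto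
    obtain A where "\<rho>\<^sub>1 \<gamma> = {A, - A}" using r1.lift_exists[OF g(1)] by blast
    with g have "(A, B) \<in> R" unfolding R_def by blast
    then show "B \<in> snd ` R" by force
  qed
  then have dense2: "{A. det A = 1} \<subseteq> closure (snd ` R)"
    using r2.lifts_dense[OF nondiscrete(2) nonelementary(2)] closure_mono by blast
  interpret order_equivalent_pairs R a\<^sub>1 a\<^sub>2
  proof (unfold_locales; (rule a dense1 dense2 det_R)?)
    fix A B A' B' assume "(A, B) \<in> R" "(A', B') \<in> R"
    then obtain \<gamma> \<delta> where "\<gamma> \<in> carrier G" "\<rho>\<^sub>1 \<gamma> = {A, - A}" "\<rho>\<^sub>2 \<gamma> = {B, - B}"
        "\<delta> \<in> carrier G" "\<rho>\<^sub>1 \<delta> = {A', - A'}" "\<rho>\<^sub>2 \<delta> = {B', - B'}"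
      using RE by meson
    then show "(A ** A', B ** B') \<in> R"
      unfolding R_def using r1.lift_mult[of \<gamma> A \<delta> A'] r2.lift_mult[of \<gamma> B \<delta> B']
      by (auto intro!: bexI[of _ "\<gamma> \<otimes>\<^bsub>G\<^esub> \<delta>"])
  next
    fix A A' B B' C C'
    assume R: "(A, A') \<in> R" "(B, B') \<in> R" "(C, C') \<in> R"
    obtain \<alpha> where \<alpha>: "\<alpha> \<in> carrier G" "\<rho>\<^sub>1 \<alpha> = {A, - A}" "\<rho>\<^sub>2 \<alpha> = {A', - A'}" using RE[OF R(1)] by blast
    obtain \<beta> where \<beta>: "\<beta> \<in> carrier G" "\<rho>\<^sub>1 \<beta> = {B, - B}" "\<rho>\<^sub>2 \<beta> = {B', - B'}" using RE[OF R(2)] by blast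
    obtain \<gamma> where \<gamma>: "\<gamma> \<in> carrier G" "\<rho>\<^sub>1 \<gamma> = {C, - C}" "\<rho>\<^sub>2 \<gamma> = {C', - C'}" using RE[OF R(3)] by blast
    have sph: "SL2R_act A a\<^sub>1 \<in> sphere 0 1" "SL2R_act B a\<^sub>1 \<in> sphere 0 1" "SL2R_act C a\<^sub>1 \<in> sphere 0 1"
      "SL2R_act A' a\<^sub>2 \<in> sphere 0 1" "SL2R_act B' a\<^sub>2 \<in> sphere 0 1" "SL2R_act C' a\<^sub>2 \<in> sphere 0 1"
      using det_R[OF R(1)] det_R[OF R(2)] det_R[OF R(3)] a by (intro SL2R_act_in_sphere; simp)+
    show "sgn (orient (SL2R_act A a\<^sub>1) (SL2R_act B a\<^sub>1) (SL2R_act C a\<^sub>1)) =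
        sgn (orient (SL2R_act A' a\<^sub>2) (SL2R_act B' a\<^sub>2) (SL2R_act C' a\<^sub>2))"
      using order[OF \<alpha>(1) \<beta>(1) \<gamma>(1)]
      unfolding \<alpha> \<beta> \<gamma> PSL2R_act_lift cyc_order_eq_sgn_orient[OF sph(1-3), symmetric]
        cyc_order_eq_sgn_orient[OF sph(4-6), symmetric] by simp
  qed
  obtain T where T: "det T = 1" "\<And>A B. (A, B) \<in> R \<Longrightarrow> A = T ** B ** adj2 T \<or> A = - (T ** B ** adj2 T)"
    using conjugate by blast
  have "\<rho>\<^sub>1 \<gamma> = {T, - T} \<otimes>\<^bsub>PSL2R\<^esub> \<rho>\<^sub>2 \<gamma> \<otimes>\<^bsub>PSL2R\<^esub> inv\<^bsub>PSL2R\<^esub> {T, - T}" if g: "\<gamma> \<in> carrier G" for \<gamma>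
  proof -
    obtain A B where AB: "\<rho>\<^sub>1 \<gamma> = {A, - A}" "\<rho>\<^sub>2 \<gamma> = {B, - B}"
      using r1.lift_exists[OF g] r2.lift_exists[OF g] by blast
    then have R: "(A, B) \<in> R" using g unfolding R_def by blast
    have "{T, - T} \<otimes>\<^bsub>PSL2R\<^esub> \<rho>\<^sub>2 \<gamma> \<otimes>\<^bsub>PSL2R\<^esub> inv\<^bsub>PSL2R\<^esub> {T, - T} = {T ** B ** adj2 T, - (T ** B ** adj2 T)}"
      using T(1) det_R[OF R] by (simp add: AB PSL2R_inv PSL2R_mult det_mul)
    \<comment> \<open>The sign left open by T disappears in the coset, which contains both
      signs.\<close>
    then show ?thesis using T(2)[OF R] AB by auto
  qed
  then show ?thesis using PSL2R_memI[OF T(1)] by blast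
qed

theorem proposition1p8:
  fixes g :: nat
    and S :: "'a::topological_space set" and x :: 'a
    and \<rho>\<^sub>1 \<rho>\<^sub>2 :: "(real \<Rightarrow> 'a) set \<Rightarrow> (real^2^2) set"
    and a\<^sub>1 a\<^sub>2 :: complex
  assumes "g \<ge> 2"
    and "closed_surface g S" and "x \<in> S"
    and "\<rho>\<^sub>1 \<in> hom (fundamental_group S x) PSL2R"
    and "\<rho>\<^sub>2 \<in> hom (fundamental_group S x) PSL2R"
    and "\<not> discrete_rep (fundamental_group S x) \<rho>\<^sub>1"
    and "\<not> discrete_rep (fundamental_group S x) \<rho>\<^sub>2"
    and "\<not> elementary_rep (fundamental_group S x) \<rho>\<^sub>1"
    and "\<not> elementary_rep (fundamental_group S x) \<rho>\<^sub>2"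
    and "a\<^sub>1 \<in> sphere 0 1" and "a\<^sub>2 \<in> sphere 0 1"
    and "\<forall>\<gamma>\<^sub>1\<in>carrier (fundamental_group S x). \<forall>\<gamma>\<^sub>2\<in>carrier (fundamental_group S x).
         \<forall>\<gamma>\<^sub>3\<in>carrier (fundamental_group S x).
           cyc_order (PSL2R_act (\<rho>\<^sub>1 \<gamma>\<^sub>1) a\<^sub>1) (PSL2R_act (\<rho>\<^sub>1 \<gamma>\<^sub>2) a\<^sub>1) (PSL2R_act (\<rho>\<^sub>1 \<gamma>\<^sub>3) a\<^sub>1) =
           cyc_order (PSL2R_act (\<rho>\<^sub>2 \<gamma>\<^sub>1) a\<^sub>2) (PSL2R_act (\<rho>\<^sub>2 \<gamma>\<^sub>2) a\<^sub>2) (PSL2R_act (\<rho>\<^sub>2 \<gamma>\<^sub>3) a\<^sub>2)"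
  shows "\<exists>A\<in>carrier PSL2R. \<forall>\<gamma>\<in>carrier (fundamental_group S x).
           \<rho>\<^sub>1 \<gamma> = A \<otimes>\<^bsub>PSL2R\<^esub> \<rho>\<^sub>2 \<gamma> \<otimes>\<^bsub>PSL2R\<^esub> inv\<^bsub>PSL2R\<^esub> A"
proof -
  have "group (fundamental_group S x)" using \<open>x \<in> S\<close> by (rule group_fundamental_group)
  then show ?thesis
    using assms by (intro conjugate_if_order_equivalent[of "fundamental_group S x" \<rho>\<^sub>1 \<rho>\<^sub>2 a\<^sub>1 a\<^sub>2])
      (simp_all add: PSL2R_rep_def)
qed

end
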